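(* Let $H$ be a Hopf algebra with twist $\mathcal F\in H\otimes H$, $\mathcal F^{-1}=\bar f^\alpha\otimes\bar f_\alpha$, let $A$ be a left $H$-module algebra, $(\Omega^\bullet,\wedge,\mathrm d)$ a left $H$-covariant differential calculus over $A$, $V$ a left $H$-module right $A$-module, $\nabla\in\mathrm{Con}_A(V)$, and let $\nabla_\star:=\widetilde D_{\mathcal F}(\nabla)\in\mathrm{Con}_{A_\star}(V_\star)$ be the quantized connection. Then the curvature $R_{\nabla_\star}=\nabla_\star\circ\nabla_\star$ of $\nabla_\star$ is $$R_{\nabla_\star}=\widetilde D_{\mathcal F}(\nabla\circ_\star\nabla),$$ where $\nabla\circ_\star\nabla:=(\bar f^\alpha\blacktriangleright\nabla)\circ(\bar f_\alpha\blacktriangleright\nabla):V\to V\otimes_A\Omega^2$.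
   Context: $\mathbb K$ is a commutative ring with unit; modules, algebras (associative, unital) and unadorned tensor products are over $\mathbb K$. For a Hopf algebra $H$ with coproduct $\Delta$, counit $\varepsilon$, antipode $S$, write $\Delta(\xi)=\xi_1\otimes\xi_2$ (sum understood). A left $H$-module algebra is an algebra $A$ with left $H$-action satisfying $\xi\triangleright(ab)=(\xi_1\triangleright a)(\xi_2\triangleright b)$, $\xi\triangleright1=\varepsilon(\xi)1$. A left $H$-module right $A$-module is a right $A$-module $V$ with left $H$-action satisfying $\xi\triangleright(v\cdot a)=(\xi_1\triangleright v)\cdot(\xi_2\triangleright a)$. A twist of $H$ is an invertible $\mathcal F\in H\otimes H$ with $(\mathcal F\otimes 1)(\Delta\otimes\mathrm{id})\mathcal F=(1\otimes\mathcal F)(\mathrm{id}\otimes\Delta)\mathcal F$ and $(\varepsilon\otimes\mathrm{id})\mathcal F=1=(\mathrm{id}\otimes\varepsilon)\mathcal F$. $H^{\mathcal F}$ is the Hopf algebra with the same algebra structure and counit as $H$, coproduct $\Delta^{\mathcal F}(\xi)=\mathcal F\Delta(\xi)\mathcal F^{-1}$, and antipode $S^{\mathcal F}(\xi)=\chi S(\xi)\chi^{-1}$, $\chi=f^\alpha S(f_\alpha)$ where $\mathcal F=f^\alpha\otimes f_\alpha$. $A_\star$ is the left $H^{\mathcal F}$-module algebra equal to $A$ as an $H$-module, with product $a\star b=(\bar f^\alpha\triangleright a)(\bar f_\alpha\triangleright b)$; $V_\star$ equals $V$ as an $H$-module, with right $A_\star$-action $v\star a=(\bar f^\alpha\triangleright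 v)\cdot(\bar f_\alpha\triangleright a)$. A differential calculus over $A$ is a graded algebra $(\Omega^\bullet=\bigoplus_{n\ge0}\Omega^n,\wedge)$ with $\Omega^0=A$ and $\mathbb K$-linear maps $\mathrm d:\Omega^n\to\Omega^{n+1}$ with $\mathrm d\circ\mathrm d=0$ and $\mathrm d(\theta\wedge\theta')=(\mathrm d\theta)\wedge\theta'+(-1)^{\deg\theta}\theta\wedge\mathrm d\theta'$, such that every $\theta\in\Omega:=\Omega^1$ is of the form $\sum_ia_i\,\mathrm db_i$ with $a_i,b_i\in A$. It is left $H$-covariant if $A$ and $\Omega^\bullet$ are left $H$-module algebras, the $H$-action preserves degree, and $\xi\triangleright\mathrm d\theta=\mathrm d(\xi\triangleright\theta)$. Then $(\Omega^\bullet_\star,\wedge_\star,\mathrm d)$, with $\theta\wedge_\star\theta'=(\bar f^\alpha\triangleright\theta)\wedge(\bar f_\alpha\triangleright\theta')$, is a left $H^{\mathcal F}$-covariant differential calculus over $A_\star$. A (right) connection on $V$ is a $\mathbb K$-linear map $\nabla:V\to V\otimes_A\Omega$ with $\nabla(v\cdot a)=(\nabla v)\cdot a+v\otimes_A\mathrm da$; $\mathrm{Con}_A(V)$ is the set of these, and $\mathrm{Con}_{A_\star}(V_\star)$ is defined likewise with $\Omega_\star$. A connection extends to a $\mathbb K$-linear map $\nabla:V\otimes_A\Omega^\bullet\to V\otimes_A\Omega^\bullet$ by $\nabla(v\otimes_A\theta)=(\nabla v)\wedge\theta+v\otimes_A\mathrm d\theta$ (similarly for $\nabla_\star$, with $\wedge_\star$),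 and its curvature is $R_\nabla:=\nabla\circ\nabla:V\to V\otimes_A\Omega^2$. In the compositions $\nabla\circ_\star\nabla$ and $\nabla_\star\circ\nabla_\star$ the left factor uses the extended map. $V\otimes_A\Omega^n$ carries the $H$-action through $\Delta$. For linear maps between left $H$-modules, $\xi\blacktriangleright P:=\xi_1\triangleright\circ P\circ S(\xi_2)\triangleright$ and $D_{\mathcal F}(P):=(\bar f^\alpha\blacktriangleright P)\circ\bar f_\alpha\triangleright$. $\varphi_{V,\Omega^n}:V_\star\otimes_{A_\star}\Omega^n_\star\to(V\otimes_A\Omega^n)_\star$ is the isomorphism $v\otimes_{A_\star}\theta\mapsto(\bar f^\alpha\triangleright v)\otimes_A(\bar f_\alpha\triangleright\theta)$. For a $\mathbb K$-linear map $P:V\to V\otimes_A\Omega^n$ ($n=1,2$), $\widetilde D_{\mathcal F}(P):=\varphi_{V,\Omega^n}^{-1}\circ D_{\mathcal F}(P):V_\star\to V_\star\otimes_{A_\star}\Omega^n_\star$; it maps $\mathrm{Con}_A(V)$ to $\mathrm{Con}_{A_\star}(V_\star)$. *)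

theory Defs
  imports Complex_Main "HOL-Library.Poly_Mapping" "HOL-Library.Set_Algebras"
begin

text \<open>
  All modules are whole types of class \<open>ab_group_add\<close> with an explicit scalar multiplication by the
  ground ring \<open>'k\<close>.  Graded pieces, and the algebra in degree 0, are subsets of the type of forms.
\<close>

section \<open>Tensor products\<close>

text \<open>
  A tensor product is the free abelian group on \<open>gens\<close> modulo the subgroup \<open>null\<close>; its elements are
  cosets.  The coset of a list of generators is the class of their sum.  As every tensor is a finite
  sum of pure tensors (negatives are absorbed into a factor), such cosets make up the whole quotient.
  Addition of cosets is the elementwise sum of sets from \<open>Set_Algebras\<close>.
\<close>

type_synonym 'g tensor = "('g \<Rightarrow>\<^sub>0 int) set"

record 'g tprod =
  gens :: "'g set"
  null :: "'g tensor"

inductive_set generated_subgroup :: "'b::ab_group_add set \<Rightarrow> 'b set" for S where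
  zero: "0 \<in> generated_subgroup S"
| gen: "x \<in> S \<Longrightarrow> x \<in> generated_subgroup S"
| diff: "x \<in> generated_subgroup S \<Longrightarrow> y \<in> generated_subgroup S \<Longrightarrow> x - y \<in> generated_subgroup S"

definition tcls :: "'g tprod \<Rightarrow> 'g list \<Rightarrow> 'g tensor" where
  "tcls T xs = (\<Sum>p\<leftarrow>xs. frag_of p) +o null T"

definition tspace :: "'g tprod \<Rightarrow> 'g tensor set" where
  "tspace T = {tcls T xs | xs. set xs \<subseteq> gens T}"

text \<open>
  \<open>trep T X\<close> is some expression of the tensor \<open>X\<close> as a sum of pure tensors.  It plays the role of
  Sweedler notation and of the notation \<open>f\<^sup>\<alpha> \<otimes> f\<^sub>\<alpha>\<close>; below it is used only in expressions that are
  multilinear and balanced, hence independent of the choice.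
\<close>

definition trep :: "'g tprod \<Rightarrow> 'g tensor \<Rightarrow> 'g list" where
  "trep T X = (SOME xs. set xs \<subseteq> gens T \<and> tcls T xs = X)"

lemma trep:
  assumes "X \<in> tspace T"
  shows "set (trep T X) \<subseteq> gens T" "tcls T (trep T X) = X"
proof -
  have "\<exists>xs. set xs \<subseteq> gens T \<and> tcls T xs = X"
    using assms by (auto simp: tspace_def)
  then have "set (trep T X) \<subseteq> gens T \<and> tcls T (trep T X) = X"
    unfolding trep_def by (rule someI_ex)
  then show "set (trep T X) \<subseteq> gens T" "tcls T (trep T X) = X"
    by auto
qed

text \<open>Adding \<open>null T\<close> only matters for the empty list, whose sum must be the zero coset.\<close>

definition tsum :: "'g tprod \<Rightarrow> 'g tensor list \<Rightarrow> 'g tensor" where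
  "tsum T Xs = sum_list Xs + null T"

text \<open>\<open>M \<otimes>\<^sub>R N\<close>, for the whole type \<open>'m\<close> as right \<open>R\<close>-module and \<open>N\<close> as left \<open>R\<close>-module.\<close>

definition tensor_prod ::
  "('m::ab_group_add \<Rightarrow> 'r \<Rightarrow> 'm) \<Rightarrow> 'r set \<Rightarrow> ('r \<Rightarrow> 'n::ab_group_add \<Rightarrow> 'n) \<Rightarrow> 'n set \<Rightarrow> ('m \<times> 'n) tprod"
where
  "tensor_prod ra R la N = \<lparr>
     gens = UNIV \<times> N,
     null = generated_subgroup
       ({frag_of (m + m', n) - frag_of (m, n) - frag_of (m', n) | m m' n. n \<in> N} \<union>
        {frag_of (m, n + n') - frag_of (m, n) - frag_of (m, n') | m n n'. n \<in> N \<and> n' \<in> N} \<union>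
        {frag_of (ra m r, n) - frag_of (m, la r n) | m r n. r \<in> R \<and> n \<in> N})\<rparr>"

text \<open>The ground ring acts on a tensor product through the left factor.\<close>

definition tscale :: "('m \<times> 'n) tprod \<Rightarrow> ('k \<Rightarrow> 'm \<Rightarrow> 'm) \<Rightarrow> 'k \<Rightarrow> ('m \<times> 'n) tensor \<Rightarrow> ('m \<times> 'n) tensor"
where
  "tscale T s k X = tcls T [(s k m, n). (m, n) \<leftarrow> trep T X]"

definition linear_to_tensor ::
  "('k \<Rightarrow> 'm::ab_group_add \<Rightarrow> 'm) \<Rightarrow> ('m \<times> 'n) tprod \<Rightarrow> ('m \<Rightarrow> ('m \<times> 'n) tensor) \<Rightarrow> bool"
where
  "linear_to_tensor s T P \<longleftrightarrow>
     (\<forall>x. P x \<in> tspace T) \<and>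
     (\<forall>x y. P (x + y) = P x + P y) \<and>
     (\<forall>k x. P (s k x) = tscale T s k (P x))"


section \<open>Hopf algebras and twists\<close>

record ('k, 'h) hopf =
  hscale :: "'k \<Rightarrow> 'h \<Rightarrow> 'h"
  coprod :: "'h \<Rightarrow> ('h \<times> 'h) tensor"
  counit :: "'h \<Rightarrow> 'k"
  antipode :: "'h \<Rightarrow> 'h"

definition HH :: "('k, 'h::ring_1) hopf \<Rightarrow> ('h \<times> 'h) tprod" where
  "HH H = tensor_prod (\<lambda>x k. hscale H k x) UNIV (hscale H) UNIV"

definition HHH :: "('k, 'h::ring_1) hopf \<Rightarrow> ('h \<times> 'h \<times> 'h) tprod" where
  "HHH H = \<lparr>
     gens = UNIV,
     null = generated_subgroup
       ({frag_of (a + a', b, c) - frag_of (a, b, c) - frag_of (a', b, c) | a a' b c. True} \<union>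
        {frag_of (a, b + b', c) - frag_of (a, b, c) - frag_of (a, b', c) | a b b' c. True} \<union>
        {frag_of (a, b, c + c') - frag_of (a, b, c) - frag_of (a, b, c') | a b c c'. True} \<union>
        {frag_of (hscale H k a, b, c) - frag_of (a, hscale H k b, c) | k a b c. True} \<union>
        {frag_of (a, hscale H k b, c) - frag_of (a, b, hscale H k c) | k a b c. True})\<rparr>"

definition hh_one :: "('k, 'h::ring_1) hopf \<Rightarrow> ('h \<times> 'h) tensor" where
  "hh_one H = tcls (HH H) [(1, 1)]"

definition hh_mult ::
  "('k, 'h::ring_1) hopf \<Rightarrow> ('h \<times> 'h) tensor \<Rightarrow> ('h \<times> 'h) tensor \<Rightarrow> ('h \<times> 'h) tensor"
where
  "hh_mult H X Y =
     tcls (HH H) [(a * a', b * b'). (a, b) \<leftarrow> trep (HH H) X, (a', b') \<leftarrow> trep (HH H) Y]"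

definition hhh_mult ::
  "('k, 'h::ring_1) hopf \<Rightarrow> ('h \<times> 'h \<times> 'h) tensor \<Rightarrow> ('h \<times> 'h \<times> 'h) tensor \<Rightarrow> ('h \<times> 'h \<times> 'h) tensor"
where
  "hhh_mult H X Y =
     tcls (HHH H) [(a * a', b * b', c * c').
       (a, b, c) \<leftarrow> trep (HHH H) X, (a', b', c') \<leftarrow> trep (HHH H) Y]"

text \<open>\<open>\<Delta> \<otimes> id\<close>, \<open>id \<otimes> \<Delta>\<close>, \<open>X \<mapsto> X \<otimes> 1\<close> and \<open>X \<mapsto> 1 \<otimes> X\<close> from \<open>H \<otimes> H\<close> to \<open>H \<otimes> H \<otimes> H\<close>.\<close>

definition coprod_id :: "('k, 'h::ring_1) hopf \<Rightarrow> ('h \<times> 'h) tensor \<Rightarrow> ('h \<times> 'h \<times> 'h) tensor" where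
  "coprod_id H X =
     tcls (HHH H) [(x, y, b). (a, b) \<leftarrow> trep (HH H) X, (x, y) \<leftarrow> trep (HH H) (coprod H a)]"

definition id_coprod :: "('k, 'h::ring_1) hopf \<Rightarrow> ('h \<times> 'h) tensor \<Rightarrow> ('h \<times> 'h \<times> 'h) tensor" where
  "id_coprod H X =
     tcls (HHH H) [(a, x, y). (a, b) \<leftarrow> trep (HH H) X, (x, y) \<leftarrow> trep (HH H) (coprod H b)]"

definition tensor_one :: "('k, 'h::ring_1) hopf \<Rightarrow> ('h \<times> 'h) tensor \<Rightarrow> ('h \<times> 'h \<times> 'h) tensor" where
  "tensor_one H X = tcls (HHH H) [(a, b, 1). (a, b) \<leftarrow> trep (HH H) X]"

definition one_tensor :: "('k, 'h::ring_1) hopf \<Rightarrow> ('h \<times> 'h) tensor \<Rightarrow> ('h \<times> 'h \<times> 'h) tensor" where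
  "one_tensor H X = tcls (HHH H) [(1, a, b). (a, b) \<leftarrow> trep (HH H) X]"

locale hopf_algebra =
  fixes H :: "('k::comm_ring_1, 'h::ring_1) hopf"
  assumes module: "module (hscale H)"
    and scale_mult_left: "\<And>k x y. hscale H k (x * y) = hscale H k x * y"
    and scale_mult_right: "\<And>k x y. hscale H k (x * y) = x * hscale H k y"
    and coprod_linear: "linear_to_tensor (hscale H) (HH H) (coprod H)"
    and coprod_mult: "\<And>x y. coprod H (x * y) = hh_mult H (coprod H x) (coprod H y)"
    and coprod_one: "coprod H 1 = hh_one H"
    and counit_linear: "module_hom (hscale H) (*) (counit H)"
    and counit_mult: "\<And>x y. counit H (x * y) = counit H x * counit H y"
    and counit_one: "counit H 1 = 1"
    and coassoc: "\<And>x. coprod_id H (coprod H x) = id_coprod H (coprod H x)"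
    and counit_left: "\<And>x. (\<Sum>(a, b)\<leftarrow>trep (HH H) (coprod H x). hscale H (counit H a) b) = x"
    and counit_right: "\<And>x. (\<Sum>(a, b)\<leftarrow>trep (HH H) (coprod H x). hscale H (counit H b) a) = x"
    and antipode_linear: "module_hom (hscale H) (hscale H) (antipode H)"
    and antipode_left:
      "\<And>x. (\<Sum>(a, b)\<leftarrow>trep (HH H) (coprod H x). antipode H a * b) = hscale H (counit H x) 1"
    and antipode_right:
      "\<And>x. (\<Sum>(a, b)\<leftarrow>trep (HH H) (coprod H x). a * antipode H b) = hscale H (counit H x) 1"

definition hh_inverse_of ::
  "('k, 'h::ring_1) hopf \<Rightarrow> ('h \<times> 'h) tensor \<Rightarrow> ('h \<times> 'h) tensor \<Rightarrow> bool"
where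
  "hh_inverse_of H F G \<longleftrightarrow> G \<in> tspace (HH H) \<and> hh_mult H F G = hh_one H \<and> hh_mult H G F = hh_one H"

definition twist :: "('k, 'h::ring_1) hopf \<Rightarrow> ('h \<times> 'h) tensor \<Rightarrow> bool" where
  "twist H F \<longleftrightarrow>
     F \<in> tspace (HH H) \<and>
     (\<exists>G. hh_inverse_of H F G) \<and>
     hhh_mult H (tensor_one H F) (coprod_id H F) = hhh_mult H (one_tensor H F) (id_coprod H F) \<and>
     (\<Sum>(a, b)\<leftarrow>trep (HH H) F. hscale H (counit H a) b) = 1 \<and>
     (\<Sum>(a, b)\<leftarrow>trep (HH H) F. hscale H (counit H b) a) = 1"

text \<open>The pairs \<open>(f\<^sup>\<alpha>, f\<^sub>\<alpha>)\<close> in an expression of the inverse of the twist.\<close>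

definition fbar :: "('k, 'h::ring_1) hopf \<Rightarrow> ('h \<times> 'h) tensor \<Rightarrow> ('h \<times> 'h) list" where
  "fbar H F = trep (HH H) (THE G. hh_inverse_of H F G)"


section \<open>Modules, algebras and calculi with an action of a Hopf algebra\<close>

record ('k, 'h, 'v) hmod =
  mscale :: "'k \<Rightarrow> 'v \<Rightarrow> 'v"
  hact :: "'h \<Rightarrow> 'v \<Rightarrow> 'v"

record ('k, 'h, 'w) halg = "('k, 'h, 'w) hmod" +
  mult :: "'w \<Rightarrow> 'w \<Rightarrow> 'w"
  unit :: 'w

record ('k, 'h, 'w) calculus = "('k, 'h, 'w) halg" +
  deg :: "nat \<Rightarrow> 'w set"
  diff :: "'w \<Rightarrow> 'w"

record ('k, 'h, 'w, 'v) rmod = "('k, 'h, 'v) hmod" +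
  ract :: "'v \<Rightarrow> 'w \<Rightarrow> 'v"

locale left_module =
  fixes H :: "('k::comm_ring_1, 'h::ring_1) hopf"
    and M :: "('k, 'h, 'v::ab_group_add, 'z) hmod_scheme"
  assumes module: "module (mscale M)"
    and act_linear: "\<And>x. module_hom (mscale M) (mscale M) (hact M x)"
    and act_linear': "\<And>v. module_hom (hscale H) (mscale M) (\<lambda>x. hact M x v)"
    and act_mult: "\<And>x y v. hact M (x * y) v = hact M x (hact M y v)"
    and act_one: "\<And>v. hact M 1 v = v"

text \<open>A left \<open>H\<close>-module algebra with carrier \<open>A\<close> inside the ambient module \<open>B\<close>.\<close>

locale module_algebra = left_module H B
  for H :: "('k::comm_ring_1, 'h::ring_1) hopf"
    and A :: "'w::ab_group_add set"
    and B :: "('k, 'h, 'w, 'z) halg_scheme" +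
  assumes subspace: "module.subspace (mscale B) A"
    and act_closed: "\<And>x a. a \<in> A \<Longrightarrow> hact B x a \<in> A"
    and mult_closed: "\<And>a b. a \<in> A \<Longrightarrow> b \<in> A \<Longrightarrow> mult B a b \<in> A"
    and unit_closed: "unit B \<in> A"
    and mult_add_left:
      "\<And>a b c. a \<in> A \<Longrightarrow> b \<in> A \<Longrightarrow> c \<in> A \<Longrightarrow> mult B (a + b) c = mult B a c + mult B b c"
    and mult_add_right:
      "\<And>a b c. a \<in> A \<Longrightarrow> b \<in> A \<Longrightarrow> c \<in> A \<Longrightarrow> mult B a (b + c) = mult B a b + mult B a c"
    and mult_scale_left:
      "\<And>k a b. a \<in> A \<Longrightarrow> b \<in> A \<Longrightarrow> mult B (mscale B k a) b = mscale B k (mult B a b)"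
    and mult_scale_right:
      "\<And>k a b. a \<in> A \<Longrightarrow> b \<in> A \<Longrightarrow> mult B a (mscale B k b) = mscale B k (mult B a b)"
    and mult_assoc:
      "\<And>a b c. a \<in> A \<Longrightarrow> b \<in> A \<Longrightarrow> c \<in> A \<Longrightarrow> mult B (mult B a b) c = mult B a (mult B b c)"
    and unit_left: "\<And>a. a \<in> A \<Longrightarrow> mult B (unit B) a = a"
    and unit_right: "\<And>a. a \<in> A \<Longrightarrow> mult B a (unit B) = a"
    and act_mult_alg: "\<And>x a b. a \<in> A \<Longrightarrow> b \<in> A \<Longrightarrow>
      hact B x (mult B a b) =
        (\<Sum>(x1, x2)\<leftarrow>trep (HH H) (coprod H x). mult B (hact B x1 a) (hact B x2 b))"
    and act_unit: "\<And>x. hact B x (unit B) = mscale B (counit H x) (unit B)"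

text \<open>
  A left \<open>H\<close>-covariant differential calculus \<open>C\<close> over \<open>A\<close>.  The algebra \<open>A\<close> is the degree 0 part of
  the graded algebra, so its product is the restriction of the product of forms.
\<close>

locale covariant_calculus =
  A: module_algebra H A C + forms: module_algebra H UNIV C
  for H :: "('k::comm_ring_1, 'h::ring_1) hopf"
    and A :: "'w::ab_group_add set"
    and C :: "('k, 'h, 'w) calculus" +
  assumes deg_zero: "deg C 0 = A"
    and deg_subspace: "\<And>n. module.subspace (mscale C) (deg C n)"
    and direct_sum:
      "\<And>w. \<exists>!f. (\<forall>n. f n \<in> deg C n) \<and> finite {n. f n \<noteq> 0} \<and> w = (\<Sum>n | f n \<noteq> 0. f n)"
    and deg_mult: "\<And>m n s t. s \<in> deg C m \<Longrightarrow> t \<in> deg C n \<Longrightarrow> mult C s t \<in> deg C (m + n)"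
    and deg_act: "\<And>n x t. t \<in> deg C n \<Longrightarrow> hact C x t \<in> deg C n"
    and diff_linear: "module_hom (mscale C) (mscale C) (diff C)"
    and deg_diff: "\<And>n t. t \<in> deg C n \<Longrightarrow> diff C t \<in> deg C (n + 1)"
    and diff_diff: "\<And>t. diff C (diff C t) = 0"
    and diff_mult: "\<And>n s t. s \<in> deg C n \<Longrightarrow>
      diff C (mult C s t) = mult C (diff C s) t + mscale C ((-1) ^ n) (mult C s (diff C t))"
    and one_forms: "\<And>t. t \<in> deg C 1 \<Longrightarrow>
      \<exists>ps. set ps \<subseteq> A \<times> A \<and> t = (\<Sum>(a, b)\<leftarrow>ps. mult C a (diff C b))"
    and act_diff: "\<And>x t. hact C x (diff C t) = diff C (hact C x t)"

locale module_right_module = left_module H V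
  for H :: "('k::comm_ring_1, 'h::ring_1) hopf"
    and A :: "'w::ab_group_add set"
    and B :: "('k, 'h, 'w, 'z) halg_scheme"
    and V :: "('k, 'h, 'w, 'v::ab_group_add) rmod" +
  assumes ract_linear: "\<And>a. a \<in> A \<Longrightarrow> module_hom (mscale V) (mscale V) (\<lambda>v. ract V v a)"
    and ract_add: "\<And>v a b. a \<in> A \<Longrightarrow> b \<in> A \<Longrightarrow> ract V v (a + b) = ract V v a + ract V v b"
    and ract_scale: "\<And>k v a. a \<in> A \<Longrightarrow> ract V v (mscale B k a) = mscale V k (ract V v a)"
    and ract_mult: "\<And>v a b. a \<in> A \<Longrightarrow> b \<in> A \<Longrightarrow> ract V v (mult B a b) = ract V (ract V v a) b"
    and ract_unit: "\<And>v. ract V v (unit B) = v"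
    and act_ract: "\<And>x v a. a \<in> A \<Longrightarrow>
      hact V x (ract V v a) =
        (\<Sum>(x1, x2)\<leftarrow>trep (HH H) (coprod H x). ract V (hact V x1 v) (hact B x2 a))"


section \<open>Connections\<close>

text \<open>\<open>tens A C V n\<close> is \<open>V \<otimes>\<^sub>A \<Omega>\<^sup>n\<close>.\<close>

definition tens ::
  "'w set \<Rightarrow> ('k, 'h, 'w::ab_group_add) calculus \<Rightarrow> ('k, 'h, 'w, 'v::ab_group_add) rmod \<Rightarrow> nat
     \<Rightarrow> ('v \<times> 'w) tprod"
where
  "tens A C V n = tensor_prod (ract V) A (mult C) (deg C n)"

definition connections ::
  "'w set \<Rightarrow> ('k, 'h, 'w::ab_group_add) calculus \<Rightarrow> ('k, 'h, 'w, 'v::ab_group_add) rmod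
     \<Rightarrow> ('v \<Rightarrow> ('v \<times> 'w) tensor) set"
where
  "connections A C V = {nabla.
     linear_to_tensor (mscale V) (tens A C V 1) nabla \<and>
     (\<forall>v. \<forall>a\<in>A. nabla (ract V v a) =
        tcls (tens A C V 1) [(u, mult C t a). (u, t) \<leftarrow> trep (tens A C V 1) (nabla v)] +
        tcls (tens A C V 1) [(v, diff C a)])}"

text \<open>
  The restriction \<open>V \<otimes>\<^sub>A \<Omega>\<^sup>n \<rightarrow> V \<otimes>\<^sub>A \<Omega>\<^sup>n\<^sup>+\<^sup>1\<close> of the extension of a connection,
  \<open>v \<otimes> \<theta> \<mapsto> (nabla v) \<and> \<theta> + v \<otimes> d \<theta>\<close>.
\<close>

definition extend_conn ::
  "'w set \<Rightarrow> ('k, 'h, 'w::ab_group_add) calculus \<Rightarrow> ('k, 'h, 'w, 'v::ab_group_add) rmod \<Rightarrow> nat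
     \<Rightarrow> ('v \<Rightarrow> ('v \<times> 'w) tensor) \<Rightarrow> ('v \<times> 'w) tensor \<Rightarrow> ('v \<times> 'w) tensor"
where
  "extend_conn A C V n nabla X =
     tsum (tens A C V (n + 1))
       [tcls (tens A C V (n + 1)) [(u, mult C s t). (u, s) \<leftarrow> trep (tens A C V 1) (nabla v)] +
        tcls (tens A C V (n + 1)) [(v, diff C t)].
        (v, t) \<leftarrow> trep (tens A C V n) X]"

definition curvature ::
  "'w set \<Rightarrow> ('k, 'h, 'w::ab_group_add) calculus \<Rightarrow> ('k, 'h, 'w, 'v::ab_group_add) rmod
     \<Rightarrow> ('v \<Rightarrow> ('v \<times> 'w) tensor) \<Rightarrow> 'v \<Rightarrow> ('v \<times> 'w) tensor"
where
  "curvature A C V nabla = extend_conn A C V 1 nabla \<circ> nabla"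


section \<open>Twist deformation\<close>

definition star_alg ::
  "('k, 'h::ring_1) hopf \<Rightarrow> ('h \<times> 'h) tensor \<Rightarrow> ('k, 'h, 'w::ab_group_add, 'z) halg_scheme
     \<Rightarrow> ('k, 'h, 'w, 'z) halg_scheme"
where
  "star_alg H F B = B\<lparr>mult := \<lambda>a b. \<Sum>(x, y)\<leftarrow>fbar H F. mult B (hact B x a) (hact B y b)\<rparr>"

definition star_mod ::
  "('k, 'h::ring_1) hopf \<Rightarrow> ('h \<times> 'h) tensor \<Rightarrow> ('k, 'h, 'w::ab_group_add, 'z) halg_scheme
     \<Rightarrow> ('k, 'h, 'w, 'v::ab_group_add) rmod \<Rightarrow> ('k, 'h, 'w, 'v) rmod"
where
  "star_mod H F B V = V\<lparr>ract := \<lambda>v a. \<Sum>(x, y)\<leftarrow>fbar H F. ract V (hact V x v) (hact B y a)\<rparr>"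

definition tens_act ::
  "('k, 'h::ring_1) hopf \<Rightarrow> 'w set \<Rightarrow> ('k, 'h, 'w::ab_group_add) calculus
     \<Rightarrow> ('k, 'h, 'w, 'v::ab_group_add) rmod \<Rightarrow> nat \<Rightarrow> 'h \<Rightarrow> ('v \<times> 'w) tensor \<Rightarrow> ('v \<times> 'w) tensor"
where
  "tens_act H A C V n x X =
     tcls (tens A C V n) [(hact V x1 v, hact C x2 t).
       (x1, x2) \<leftarrow> trep (HH H) (coprod H x), (v, t) \<leftarrow> trep (tens A C V n) X]"

text \<open>
  The action \<open>\<xi>\<^sub>1 \<triangleright> \<circ> P \<circ> S(\<xi>\<^sub>2) \<triangleright>\<close> on a linear map \<open>P\<close> into a tensor product \<open>T\<close>; here \<open>actX\<close> and
  \<open>actT\<close> are the actions on the source and on the target.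
\<close>

definition map_act ::
  "('k, 'h::ring_1) hopf \<Rightarrow> 'g tprod \<Rightarrow> ('h \<Rightarrow> 'x \<Rightarrow> 'x) \<Rightarrow> ('h \<Rightarrow> 'g tensor \<Rightarrow> 'g tensor)
     \<Rightarrow> 'h \<Rightarrow> ('x \<Rightarrow> 'g tensor) \<Rightarrow> 'x \<Rightarrow> 'g tensor"
where
  "map_act H T actX actT x P =
     (\<lambda>v. tsum T [actT x1 (P (actX (antipode H x2) v)). (x1, x2) \<leftarrow> trep (HH H) (coprod H x)])"

text \<open>\<open>D\<^sub>F(P)\<close>\<close>

definition DF ::
  "('k, 'h::ring_1) hopf \<Rightarrow> ('h \<times> 'h) tensor \<Rightarrow> 'g tprod \<Rightarrow> ('h \<Rightarrow> 'x \<Rightarrow> 'x)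
     \<Rightarrow> ('h \<Rightarrow> 'g tensor \<Rightarrow> 'g tensor) \<Rightarrow> ('x \<Rightarrow> 'g tensor) \<Rightarrow> 'x \<Rightarrow> 'g tensor"
where
  "DF H F T actX actT P =
     (\<lambda>v. tsum T [map_act H T actX actT x P (actX y v). (x, y) \<leftarrow> fbar H F])"

text \<open>\<open>\<phi> : V\<^sub>\<star> \<otimes> \<Omega>\<^sup>n\<^sub>\<star> \<rightarrow> (V \<otimes> \<Omega>\<^sup>n)\<^sub>\<star>\<close>, where the first tensor product is over \<open>A\<^sub>\<star>\<close>.\<close>

definition phi ::
  "('k, 'h::ring_1) hopf \<Rightarrow> ('h \<times> 'h) tensor \<Rightarrow> 'w set \<Rightarrow> ('k, 'h, 'w::ab_group_add) calculus
     \<Rightarrow> ('k, 'h, 'w, 'v::ab_group_add) rmod \<Rightarrow> nat \<Rightarrow> ('v \<times> 'w) tensor \<Rightarrow> ('v \<times> 'w) tensor"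
where
  "phi H F A C V n X =
     tcls (tens A C V n) [(hact V x v, hact C y t).
       (v, t) \<leftarrow> trep (tens A (star_alg H F C) (star_mod H F C V) n) X, (x, y) \<leftarrow> fbar H F]"

text \<open>\<open>\<phi>\<^sup>-\<^sup>1 \<circ> D\<^sub>F(P)\<close> for \<open>P : V \<rightarrow> V \<otimes>\<^sub>A \<Omega>\<^sup>n\<close>\<close>

definition DF_tilde ::
  "('k, 'h::ring_1) hopf \<Rightarrow> ('h \<times> 'h) tensor \<Rightarrow> 'w set \<Rightarrow> ('k, 'h, 'w::ab_group_add) calculus
     \<Rightarrow> ('k, 'h, 'w, 'v::ab_group_add) rmod \<Rightarrow> nat \<Rightarrow> ('v \<Rightarrow> ('v \<times> 'w) tensor)
     \<Rightarrow> 'v \<Rightarrow> ('v \<times> 'w) tensor"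
where
  "DF_tilde H F A C V n P =
     inv_into (tspace (tens A (star_alg H F C) (star_mod H F C V) n)) (phi H F A C V n) \<circ>
     DF H F (tens A C V n) (hact V) (tens_act H A C V n) P"

text \<open>
  \<open>nabla \<circ>\<^sub>\<star> nabla\<close>: the left factor is the action on the extended map from \<open>V \<otimes>\<^sub>A \<Omega>\<^sup>1\<close> to \<open>V \<otimes>\<^sub>A \<Omega>\<^sup>2\<close>.
\<close>

definition star_square ::
  "('k, 'h::ring_1) hopf \<Rightarrow> ('h \<times> 'h) tensor \<Rightarrow> 'w set \<Rightarrow> ('k, 'h, 'w::ab_group_add) calculus
     \<Rightarrow> ('k, 'h, 'w, 'v::ab_group_add) rmod \<Rightarrow> ('v \<Rightarrow> ('v \<times> 'w) tensor) \<Rightarrow> 'v \<Rightarrow> ('v \<times> 'w) tensor"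
where
  "star_square H F A C V nabla v =
     tsum (tens A C V 2)
       [(map_act H (tens A C V 2) (tens_act H A C V 1) (tens_act H A C V 2) x (extend_conn A C V 1 nabla) \<circ>
         map_act H (tens A C V 1) (hact V) (tens_act H A C V 1) y nabla) v.
        (x, y) \<leftarrow> fbar H F]"

end

theory Submission
  imports Defs "HOL-Library.Function_Algebras" "HOL-Library.Multiset"
begin

text \<open>
  A tensor is determined by the values on it of all balanced functions into abelian groups, so every
  identity between tensors is tested against such functions, and operations on tensors become
  operations on test functions.  Sweedler computations are then equations between finite sums in
  which multilinear functions absorb the Hopf algebra and twist identities.

  For an operator \<open>P\<close> between \<open>H\<close>-modules, the function \<open>(\<xi>, \<eta>) \<mapsto> (\<xi>\<cdot>P)(\<eta> v)\<close>, where \<open>\<xi>\<cdot>P\<close> is the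
  adjoint action, is \<open>(\<xi>, \<eta>) \<mapsto> \<xi> P(\<eta> v)\<close> composed with the inverse of \<open>\<xi> \<otimes> \<eta> \<mapsto> \<xi>\<^sub>1 \<otimes> \<xi>\<^sub>2 \<eta>\<close>.  This
  characterisation makes it unnecessary to know that the antipode is an anti-homomorphism.  The cocycle
  identity of the inverse twist gives on the one hand \<open>D(\<nabla> \<circ>\<^sub>\<star> \<nabla>) = D(\<nabla>) \<circ> D(\<nabla>)\<close>, with the left
  factor extended to \<open>V \<otimes> \<Omega>\<close>, and on the other hand that \<open>\<phi>\<close> intertwines the extension of
  \<open>\<phi>\<^sup>-\<^sup>1 D(\<nabla>)\<close> with \<open>D\<close> of the extension of \<open>\<nabla>\<close>.
\<close>

text \<open>The operations on tensors are defined through arbitrarily chosen expressions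
  \<open>trep\<close>, so they cannot be manipulated directly. On the dual side, well-definedness
  over \<open>A\<close> becomes the statement that the transpose of a test function is again a test
  function, and the choice is eliminated in \<open>tval_tcls\<close>. For this to lose no
  information, two gaps must be closed: there must be one type of values in which test functions
  separate tensors, although the relations depend on variables; and a function balanced on a single
  \<Omega>^n must extend to all forms, which is done by projecting to a homogeneous component. The
  antipode enters through one fact: \<xi> \<otimes> \<eta> \<mapsto> \<xi>_1 \<otimes> S(\<xi>_2)
  \<eta> inverts \<xi> \<otimes> \<eta> \<mapsto> \<xi>_1 \<otimes> \<xi>_2 \<eta>. Identities
  between adjoint actions are therefore checked after composition with the second map, where S has
  disappeared. The curvature is compared with the right-hand side only after applying \<phi>,
  because D takes values in the undeformed tensor product; injectivity of \<phi> transports the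
  result back.\<close>

hide_const (open) Multiset.mult

declare One_nat_def [simp del]

section \<open>Subgroups of an abelian group\<close>

definition is_subgroup :: "'b::ab_group_add set \<Rightarrow> bool" where
  "is_subgroup N \<longleftrightarrow> 0 \<in> N \<and> (\<forall>x\<in>N. \<forall>y\<in>N. x - y \<in> N)"

lemma is_subgroup_uminus: "is_subgroup N \<Longrightarrow> x \<in> N \<Longrightarrow> - x \<in> N"
  unfolding is_subgroup_def by (metis diff_0)

lemma is_subgroup_add: "is_subgroup N \<Longrightarrow> x \<in> N \<Longrightarrow> y \<in> N \<Longrightarrow> x + y \<in> N"
  by (metis is_subgroup_uminus diff_minus_eq_add is_subgroup_def)

lemma is_subgroup_generated: "is_subgroup (generated_subgroup S)"
  by (simp add: is_subgroup_def generated_subgroup.zero generated_subgroup.diff)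

lemma generated_subgroup_subset:
  assumes "is_subgroup N" "S \<subseteq> N"
  shows "generated_subgroup S \<subseteq> N"
proof
  fix x assume "x \<in> generated_subgroup S"
  then show "x \<in> N"
    by induction (use assms in \<open>auto simp: is_subgroup_def\<close>)
qed

section \<open>All quotients of a group in one type\<close>

text \<open>
  A quotient \<open>G / N\<close> is not a type when \<open>N\<close> is a variable, but the product of the quotients of \<open>G\<close> by
  all its subgroups is, and every \<open>G / N\<close> embeds into it.
\<close>

definition allquot_rel :: "('b::ab_group_add set \<Rightarrow> 'b) \<Rightarrow> ('b set \<Rightarrow> 'b) \<Rightarrow> bool" where
  "allquot_rel h h' \<longleftrightarrow> (\<forall>N. is_subgroup N \<longrightarrow> h N - h' N \<in> N)"

lemma equivp_allquot_rel: "equivp allquot_rel"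
proof (rule equivpI)
  show "reflp allquot_rel"
    by (auto simp: reflp_def allquot_rel_def is_subgroup_def)
  show "symp allquot_rel"
    unfolding symp_def allquot_rel_def by (metis is_subgroup_uminus minus_diff_eq)
  show "transp allquot_rel"
    unfolding transp_def allquot_rel_def
    by (metis is_subgroup_add add_diff_eq diff_add_cancel)
qed

quotient_type (overloaded) 'b allquot = "'b::ab_group_add set \<Rightarrow> 'b" / allquot_rel
  by (rule equivp_allquot_rel)

instantiation allquot :: (ab_group_add) ab_group_add
begin

lift_definition zero_allquot :: "'a allquot" is "\<lambda>_. 0" .

lift_definition plus_allquot :: "'a allquot \<Rightarrow> 'a allquot \<Rightarrow> 'a allquot" is "\<lambda>f g N. f N + g N"
  unfolding allquot_rel_def by (simp add: add_diff_add is_subgroup_add)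

lift_definition uminus_allquot :: "'a allquot \<Rightarrow> 'a allquot" is "\<lambda>f N. - f N"
  unfolding allquot_rel_def by (metis is_subgroup_uminus minus_diff_eq minus_diff_minus)

lift_definition minus_allquot :: "'a allquot \<Rightarrow> 'a allquot \<Rightarrow> 'a allquot" is "\<lambda>f g N. f N - g N"
proof -
  fix f1 f2 g1 g2 :: "'a set \<Rightarrow> 'a"
  assume "allquot_rel f1 f2" "allquot_rel g1 g2"
  moreover have "f1 N - g1 N - (f2 N - g2 N) = (f1 N - f2 N) - (g1 N - g2 N)" for N
    by simp
  ultimately show "allquot_rel (\<lambda>N. f1 N - g1 N) (\<lambda>N. f2 N - g2 N)"
    unfolding allquot_rel_def is_subgroup_def by metis
qed

instance
  by standard (transfer, simp add: algebra_simps allquot_rel_def is_subgroup_def)+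

end

text \<open>The map from the group to its quotient by \<open>N\<close>, followed by the inclusion of
  that factor into the product: the entry is \<open>x\<close> at \<open>N\<close> and 0 at every
  other subgroup. Hence its kernel is \<open>N\<close> if \<open>N\<close> is a subgroup.\<close>

lift_definition quot_proj :: "'b::ab_group_add set \<Rightarrow> 'b \<Rightarrow> 'b allquot"
  is "\<lambda>N x M. if M = N then x else 0" .

lemma quot_proj_add: "quot_proj N (x + y) = quot_proj N x + quot_proj N y"
  by transfer (auto simp: allquot_rel_def is_subgroup_def)

lemma quot_proj_diff: "quot_proj N (x - y) = quot_proj N x - quot_proj N y"
  by transfer (auto simp: allquot_rel_def is_subgroup_def)

lemma quot_proj_zero: "quot_proj N 0 = 0"
  by transfer (auto simp: allquot_rel_def is_subgroup_def)

lemma quot_proj_eq_iff: "is_subgroup N \<Longrightarrow> quot_proj N x = quot_proj N y \<longleftrightarrow> x - y \<in> N"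
  by transfer (auto simp: allquot_rel_def is_subgroup_def)

section \<open>Evaluating functions on tensors\<close>

definition tval :: "'g tprod \<Rightarrow> ('g \<Rightarrow> 'b::ab_group_add) \<Rightarrow> 'g tensor \<Rightarrow> 'b" where
  "tval T g X = (\<Sum>p\<leftarrow>trep T X. g p)"

text \<open>Says that the additive extension of \<open>g\<close> to the free abelian group vanishes
  on \<open>null T\<close>. Writing a relation as a difference of two lists avoids defining this
  extension; by \<open>sum_list_map_eq_of_frag\<close> the choice of the lists does not
  matter.\<close>

definition balanced :: "'g tprod \<Rightarrow> ('g \<Rightarrow> 'b::ab_group_add) \<Rightarrow> bool" where
  "balanced T g \<longleftrightarrow> (\<forall>x\<in>null T. \<exists>ps ns. x = (\<Sum>p\<leftarrow>ps. frag_of p) - (\<Sum>p\<leftarrow>ns. frag_of p) \<and>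
     (\<Sum>p\<leftarrow>ps. g p) = (\<Sum>p\<leftarrow>ns. g p))"

lemma lookup_sum_frag_of:
  "Poly_Mapping.lookup (\<Sum>p\<leftarrow>xs. frag_of p) a = int (count (mset xs) a)"
  by (induction xs) (auto simp: lookup_add)

text \<open>The coefficients of a formal sum of generators are multiplicities, so the two lists
  agree as multisets.\<close>

lemma sum_list_map_eq_of_frag:
  fixes g :: "'g \<Rightarrow> 'b::comm_monoid_add"
  assumes "(\<Sum>p\<leftarrow>xs. frag_of p) = (\<Sum>p\<leftarrow>ys. frag_of p)"
  shows "(\<Sum>p\<leftarrow>xs. g p) = (\<Sum>p\<leftarrow>ys. g p)"
proof -
  have "mset xs = mset ys"
    by (rule multiset_eqI) (metis assms lookup_sum_frag_of of_nat_eq_iff)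
  then show ?thesis
    by (metis mset_map sum_mset_sum_list)
qed

lemma tcls_eq_iff:
  assumes "is_subgroup (null T)"
  shows "tcls T xs = tcls T ys \<longleftrightarrow> (\<Sum>p\<leftarrow>xs. frag_of p) - (\<Sum>p\<leftarrow>ys. frag_of p) \<in> null T"
    (is "_ \<longleftrightarrow> ?x - ?y \<in> _")
proof
  assume "tcls T xs = tcls T ys"
  moreover have "?x \<in> ?x +o null T"
    using assms set_plus_intro2[of 0 "null T" ?x] by (simp add: is_subgroup_def)
  ultimately show "?x - ?y \<in> null T"
    by (simp add: tcls_def set_minus_plus)
next
  assume d: "?x - ?y \<in> null T"
  have "a +o null T \<subseteq> b +o null T" if "a - b \<in> null T" for a b
  proof
    fix z assume "z \<in> a +o null T"
    then have "(z - a) + (a - b) \<in> null T"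
      using that assms by (intro is_subgroup_add) (auto simp: set_minus_plus)
    then show "z \<in> b +o null T"
      by (simp add: set_minus_plus)
  qed
  moreover have "?y - ?x \<in> null T"
    by (metis d assms is_subgroup_uminus minus_diff_eq)
  ultimately show "tcls T xs = tcls T ys"
    unfolding tcls_def using d by (simp add: subset_antisym)
qed

lemma tcls_in_tspace: "set xs \<subseteq> gens T \<Longrightarrow> tcls T xs \<in> tspace T"
  by (auto simp: tspace_def)

text \<open>Here the arbitrary choice in \<open>trep\<close> disappears. Two expressions of one
  tensor differ by a relation; moving its negative part to the other side leaves an equality between
  sums of generators, to which \<open>g\<close> can be applied.\<close>

lemma tval_tcls:
  assumes N: "is_subgroup (null T)" and g: "balanced T g" and xs: "set xs \<subseteq> gens T"
  shows "tval T g (tcls T xs) = (\<Sum>p\<leftarrow>xs. g p)"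
proof -
  let ?ys = "trep T (tcls T xs)"
  have "tcls T ?ys = tcls T xs"
    using trep(2)[OF tcls_in_tspace[OF xs]] .
  then obtain ps ns
    where *: "(\<Sum>p\<leftarrow>?ys. frag_of p) - (\<Sum>p\<leftarrow>xs. frag_of p) = (\<Sum>p\<leftarrow>ps. frag_of p) - (\<Sum>p\<leftarrow>ns. frag_of p)"
      and eq: "(\<Sum>p\<leftarrow>ps. g p) = (\<Sum>p\<leftarrow>ns. g p)"
    using g by (auto simp: tcls_eq_iff[OF N] balanced_def)
  have "(\<Sum>p\<leftarrow>?ys @ ns. frag_of p) = (\<Sum>p\<leftarrow>xs @ ps. frag_of p)"
    using * by (simp add: algebra_simps)
  then have "(\<Sum>p\<leftarrow>?ys @ ns. g p) = (\<Sum>p\<leftarrow>xs @ ps. g p)"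
    by (rule sum_list_map_eq_of_frag)
  then show ?thesis
    by (simp add: tval_def eq)
qed

text \<open>The elements for which suitable lists exist form a subgroup, so it suffices to treat
  generators of the relations.\<close>

lemma balancedI:
  assumes "null T = generated_subgroup S"
    and "\<And>x. x \<in> S \<Longrightarrow> \<exists>ps ns. x = (\<Sum>p\<leftarrow>ps. frag_of p) - (\<Sum>p\<leftarrow>ns. frag_of p) \<and>
     (\<Sum>p\<leftarrow>ps. g p) = (\<Sum>p\<leftarrow>ns. g p)"
  shows "balanced T g"
proof -
  let ?N = "{x. \<exists>ps ns. x = (\<Sum>p\<leftarrow>ps. frag_of p) - (\<Sum>p\<leftarrow>ns. frag_of p) \<and>
     (\<Sum>p\<leftarrow>ps. g p) = (\<Sum>p\<leftarrow>ns. g p)}"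
  have "x - y \<in> ?N" if xy: "x \<in> ?N" "y \<in> ?N" for x y
  proof -
    obtain ps ns qs ms where
      "x = (\<Sum>p\<leftarrow>ps. frag_of p) - (\<Sum>p\<leftarrow>ns. frag_of p)" "(\<Sum>p\<leftarrow>ps. g p) = (\<Sum>p\<leftarrow>ns. g p)"
      "y = (\<Sum>p\<leftarrow>qs. frag_of p) - (\<Sum>p\<leftarrow>ms. frag_of p)" "(\<Sum>p\<leftarrow>qs. g p) = (\<Sum>p\<leftarrow>ms. g p)"
      using xy by blast
    then have "x - y = (\<Sum>p\<leftarrow>ps @ ms. frag_of p) - (\<Sum>p\<leftarrow>ns @ qs. frag_of p) \<and>
        (\<Sum>p\<leftarrow>ps @ ms. g p) = (\<Sum>p\<leftarrow>ns @ qs. g p)"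
      by simp
    then show ?thesis by blast
  qed
  moreover have "0 \<in> ?N"
    by (auto intro!: exI[of _ "[]"])
  ultimately have "is_subgroup ?N"
    by (simp add: is_subgroup_def del: mem_Collect_eq)
  moreover have "S \<subseteq> ?N"
    using assms(2) by blast
  ultimately have "null T \<subseteq> ?N"
    unfolding assms(1) by (rule generated_subgroup_subset)
  then show ?thesis
    unfolding balanced_def by blast
qed

lemma tcls_append:
  assumes "is_subgroup (null T)"
  shows "tcls T (xs @ ys) = tcls T xs + tcls T ys"
proof -
  have "null T + null T = null T"
    using assms by (metis is_subgroup_add is_subgroup_def set_plus_elim set_zero_plus2 subsetI subset_antisym)
  then show ?thesis
    by (simp add: tcls_def set_plus_rearrange)
qed

lemma tsum_Nil: "tsum T [] = tcls T []"
  by (simp add: tsum_def tcls_def)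

lemma tsum_Cons: "tsum T (X # Xs) = X + tsum T Xs"
  by (simp add: tsum_def add.assoc)

lemma tspace_add:
  assumes "is_subgroup (null T)" "X \<in> tspace T" "Y \<in> tspace T"
  shows "X + Y \<in> tspace T"
proof -
  obtain xs ys where "X = tcls T xs" "set xs \<subseteq> gens T" "Y = tcls T ys" "set ys \<subseteq> gens T"
    using assms by (auto simp: tspace_def)
  then show ?thesis
    using tcls_in_tspace[of "xs @ ys" T] by (simp add: tcls_append[OF assms(1)])
qed

lemma tval_add:
  assumes "is_subgroup (null T)" "balanced T g" "X \<in> tspace T" "Y \<in> tspace T"
  shows "tval T g (X + Y) = tval T g X + tval T g Y"
proof -
  obtain xs ys where "X = tcls T xs" "set xs \<subseteq> gens T" "Y = tcls T ys" "set ys \<subseteq> gens T"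
    using assms by (auto simp: tspace_def)
  then show ?thesis
    using tval_tcls[OF assms(1,2)] by (simp flip: tcls_append[OF assms(1)])
qed

lemma tspace_tsum:
  assumes "is_subgroup (null T)" "set Xs \<subseteq> tspace T"
  shows "tsum T Xs \<in> tspace T"
  using assms(2)
  by (induction Xs) (auto simp: tsum_Nil tsum_Cons tcls_in_tspace intro: tspace_add[OF assms(1)])

lemma tval_tsum:
  assumes "is_subgroup (null T)" "balanced T g" "set Xs \<subseteq> tspace T"
  shows "tval T g (tsum T Xs) = (\<Sum>X\<leftarrow>Xs. tval T g X)"
  using assms(3)
  by (induction Xs)
    (simp_all add: tsum_Nil tsum_Cons tval_tcls[OF assms(1,2)] tval_add[OF assms(1,2)]
      tspace_tsum[OF assms(1)])

section \<open>Sums over tensors with two factors\<close>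

text \<open>Sweedler sums are nested instances of this curried form, in which the order of summation
  is changed by rewriting with \<open>sum2_swap\<close>.\<close>

definition sum2 :: "('m \<times> 'n) list \<Rightarrow> ('m \<Rightarrow> 'n \<Rightarrow> 'b::comm_monoid_add) \<Rightarrow> 'b" where
  "sum2 xs g = (\<Sum>(a, b)\<leftarrow>xs. g a b)"

lemma sum2_simps [simp]: "sum2 [] g = 0" "sum2 ((a, b) # xs) g = g a b + sum2 xs g"
  by (simp_all add: sum2_def)

lemma sum2_add: "sum2 xs (\<lambda>a b. f a b + g a b) = sum2 xs f + sum2 xs g"
  by (induction xs) (auto simp: algebra_simps)

lemma sum2_zero: "sum2 xs (\<lambda>a b. 0) = 0"
  by (induction xs) auto

lemma sum2_swap:
  "sum2 xs (\<lambda>a b. sum2 ys (\<lambda>c d. g a b c d)) = sum2 ys (\<lambda>c d. sum2 xs (\<lambda>a b. g a b c d))"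
  by (induction xs) (auto simp: sum2_add sum2_zero)

lemma sum2_cong:
  "(\<And>a b. (a, b) \<in> set xs \<Longrightarrow> f a b = g a b) \<Longrightarrow> sum2 xs f = sum2 xs g"
  by (induction xs) auto

lemma sum2_hom:
  fixes f :: "'a::ab_group_add \<Rightarrow> 'b::ab_group_add"
  assumes "\<And>x y. f (x + y) = f x + f y"
  shows "f (sum2 xs g) = sum2 xs (\<lambda>a b. f (g a b))"
proof -
  have "f 0 = 0"
    by (metis add_cancel_right_right assms)
  then show ?thesis
    by (induction xs) (auto simp: assms)
qed

lemma sum_list_concat_map: "(\<Sum>p\<leftarrow>concat (map f xs). g p) = (\<Sum>x\<leftarrow>xs. \<Sum>p\<leftarrow>f x. g p)"
  for g :: "_ \<Rightarrow> 'b::comm_monoid_add"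
  by (induction xs) auto

definition pair :: "('m \<times> 'n) tprod \<Rightarrow> ('m \<Rightarrow> 'n \<Rightarrow> 'b::ab_group_add) \<Rightarrow> ('m \<times> 'n) tensor \<Rightarrow> 'b" where
  "pair T g X = sum2 (trep T X) g"

lemma pair_tval: "pair T g X = tval T (\<lambda>(a, b). g a b) X"
  by (simp add: pair_def sum2_def tval_def)

definition bilin ::
  "('m::ab_group_add \<Rightarrow> 'r \<Rightarrow> 'm) \<Rightarrow> 'r set \<Rightarrow> ('r \<Rightarrow> 'n::ab_group_add \<Rightarrow> 'n) \<Rightarrow> 'n set
     \<Rightarrow> ('m \<Rightarrow> 'n \<Rightarrow> 'b::ab_group_add) \<Rightarrow> bool"
where
  "bilin ra R la N g \<longleftrightarrow>
     (\<forall>m m'. \<forall>n\<in>N. g (m + m') n = g m n + g m' n) \<and>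
     (\<forall>m. \<forall>n\<in>N. \<forall>n'\<in>N. g m (n + n') = g m n + g m n') \<and>
     (\<forall>m. \<forall>r\<in>R. \<forall>n\<in>N. g (ra m r) n = g m (la r n))"

lemma subgroup_null_tensor_prod: "is_subgroup (null (tensor_prod ra R la N))"
  by (simp add: tensor_prod_def is_subgroup_generated)

lemma gens_tensor_prod [simp]: "gens (tensor_prod ra R la N) = UNIV \<times> N"
  by (simp add: tensor_prod_def)

lemma balanced_tensor_prod:
  assumes "bilin ra R la N g"
  shows "balanced (tensor_prod ra R la N) (\<lambda>(a, b). g a b)"
proof (rule balancedI)
  show "null (tensor_prod ra R la N) = generated_subgroup (
        {frag_of (m + m', n) - frag_of (m, n) - frag_of (m', n) | m m' n. n \<in> N} \<union>
        {frag_of (m, n + n') - frag_of (m, n) - frag_of (m, n') | m n n'. n \<in> N \<and> n' \<in> N} \<union>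
        {frag_of (ra m r, n) - frag_of (m, la r n) | m r n. r \<in> R \<and> n \<in> N})"
    (is "_ = generated_subgroup ?S")
    by (simp add: tensor_prod_def)
  let ?g = "\<lambda>(a, b). g a b"
  fix x assume "x \<in> ?S"
  then consider
      m m' n where "n \<in> N" "x = frag_of (m + m', n) - frag_of (m, n) - frag_of (m', n)"
    | m n n' where "n \<in> N" "n' \<in> N" "x = frag_of (m, n + n') - frag_of (m, n) - frag_of (m, n')"
    | m r n where "r \<in> R" "n \<in> N" "x = frag_of (ra m r, n) - frag_of (m, la r n)"
    by blast
  then show "\<exists>ps ns. x = (\<Sum>p\<leftarrow>ps. frag_of p) - (\<Sum>p\<leftarrow>ns. frag_of p) \<and>
     (\<Sum>p\<leftarrow>ps. ?g p) = (\<Sum>p\<leftarrow>ns. ?g p)"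
  proof cases
    case 1
    show ?thesis
      using 1 assms
      by (intro exI[of _ "[(m + m', n)]"] exI[of _ "[(m, n), (m', n)]"]) (auto simp: bilin_def)
  next
    case 2
    show ?thesis
      using 2 assms
      by (intro exI[of _ "[(m, n + n')]"] exI[of _ "[(m, n), (m, n')]"]) (auto simp: bilin_def)
  next
    case 3
    show ?thesis
      using 3 assms
      by (intro exI[of _ "[(ra m r, n)]"] exI[of _ "[(m, la r n)]"]) (auto simp: bilin_def)
  qed
qed

lemma
  assumes g: "bilin ra R la N g"
  shows pair_tcls: "set xs \<subseteq> UNIV \<times> N \<Longrightarrow> pair (tensor_prod ra R la N) g (tcls (tensor_prod ra R la N) xs) = sum2 xs g"
    and pair_add: "X \<in> tspace (tensor_prod ra R la N) \<Longrightarrow> Y \<in> tspace (tensor_prod ra R la N) \<Longrightarrow>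
      pair (tensor_prod ra R la N) g (X + Y) = pair (tensor_prod ra R la N) g X + pair (tensor_prod ra R la N) g Y"
    and pair_tsum: "set Xs \<subseteq> tspace (tensor_prod ra R la N) \<Longrightarrow>
      pair (tensor_prod ra R la N) g (tsum (tensor_prod ra R la N) Xs) = (\<Sum>X\<leftarrow>Xs. pair (tensor_prod ra R la N) g X)"
  using tval_tcls[OF subgroup_null_tensor_prod balanced_tensor_prod[OF g]]
    tval_add[OF subgroup_null_tensor_prod balanced_tensor_prod[OF g]]
    tval_tsum[OF subgroup_null_tensor_prod balanced_tensor_prod[OF g]]
  by (simp_all add: pair_tval sum2_def)

text \<open>
  With values in functions on \<open>'k\<close>, balanced functions become \<open>'k\<close>-linear for this action, so
  that linearity can be required in each variable separately.  Additivity in \<open>k\<close> fails, and is never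
  required of the scalar action on the values.
\<close>

definition fsc :: "'k::comm_ring_1 \<Rightarrow> ('k \<Rightarrow> 'b) \<Rightarrow> 'k \<Rightarrow> 'b" where
  "fsc k f = (\<lambda>k'. f (k' * k))"

text \<open>The universal balanced map, sending a pure tensor to its class in the quotient by
  \<open>null T\<close>, is itself available as a test function. To make it linear for
  \<open>fsc\<close> it is replaced by the function of \<open>k\<close> that gives the class of the
  tensor with left factor multiplied by \<open>k\<close>; its value at 1 recovers the
  tensor.\<close>

lemma tensor_eqI:
  fixes s :: "'k::comm_ring_1 \<Rightarrow> 'm::ab_group_add \<Rightarrow> 'm"
  assumes T: "T = tensor_prod ra R la N"
    and X: "X \<in> tspace T" and Y: "Y \<in> tspace T"
    and s_add: "\<And>k x y. s k (x + y) = s k x + s k y"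
    and s_mult: "\<And>k k' x. s k (s k' x) = s (k * k') x"
    and s_one: "\<And>x. s 1 x = x"
    and s_ra: "\<And>k x r. r \<in> R \<Longrightarrow> s k (ra x r) = ra (s k x) r"
    and eq: "\<And>g :: 'm \<Rightarrow> 'n::ab_group_add \<Rightarrow> 'k \<Rightarrow> ('m \<times> 'n \<Rightarrow>\<^sub>0 int) allquot.
      bilin ra R la N g \<Longrightarrow> (\<And>k m n. n \<in> N \<Longrightarrow> g (s k m) n = fsc k (g m n)) \<Longrightarrow>
      pair T g X = pair T g Y"
  shows "X = Y"
proof -
  let ?p = "\<lambda>m n. quot_proj (null T) (frag_of (m, n))"
  let ?g = "\<lambda>m n k. ?p (s k m) n"
  have N: "is_subgroup (null T)"
    unfolding T by (rule subgroup_null_tensor_prod)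
  have nullT: "null T = generated_subgroup (
        {frag_of (m + m', n) - frag_of (m, n) - frag_of (m', n) | m m' n. n \<in> N} \<union>
        {frag_of (m, n + n') - frag_of (m, n) - frag_of (m, n') | m n n'. n \<in> N \<and> n' \<in> N} \<union>
        {frag_of (ra m r, n) - frag_of (m, la r n) | m r n. r \<in> R \<and> n \<in> N})"
    by (simp add: T tensor_prod_def)
  have zero: "quot_proj (null T) x = 0" if "x \<in> null T" for x
    using that quot_proj_eq_iff[OF N, of x 0] by (simp add: quot_proj_zero)
  have p: "?p (m + m') n = ?p m n + ?p m' n" "n' \<in> N \<Longrightarrow> ?p m (n + n') = ?p m n + ?p m n'"
    "r \<in> R \<Longrightarrow> ?p (ra m r) n = ?p m (la r n)" if "n \<in> N" for m m' n n' r
  proof -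
    have "frag_of (m + m', n) - frag_of (m, n) - frag_of (m', n) \<in> null T"
      unfolding nullT by (rule generated_subgroup.gen) (use that in blast)
    from zero[OF this] show "?p (m + m') n = ?p m n + ?p m' n"
      by (simp only: quot_proj_diff quot_proj_add diff_diff_eq right_minus_eq)
    show "?p m (n + n') = ?p m n + ?p m n'" if "n' \<in> N"
    proof -
      have "frag_of (m, n + n') - frag_of (m, n) - frag_of (m, n') \<in> null T"
        unfolding nullT by (rule generated_subgroup.gen) (use that \<open>n \<in> N\<close> in blast)
      from zero[OF this] show ?thesis
        by (simp only: quot_proj_diff quot_proj_add diff_diff_eq right_minus_eq)
    qed
    show "?p (ra m r) n = ?p m (la r n)" if "r \<in> R"
    proof -
      have "frag_of (ra m r, n) - frag_of (m, la r n) \<in> null T"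
        unfolding nullT by (rule generated_subgroup.gen) (use that \<open>n \<in> N\<close> in blast)
      from zero[OF this] show ?thesis
        by (simp add: quot_proj_diff)
    qed
  qed
  have "bilin ra R la N ?g"
    by (auto simp: bilin_def s_add s_ra p fun_eq_iff)
  moreover have "?g (s k m) n = fsc k (?g m n)" for k m n
    by (simp add: fsc_def s_mult)
  ultimately have "pair T ?g X 1 = pair T ?g Y 1"
    using eq[of ?g] by simp
  moreover have "sum2 xs ?g 1 = quot_proj (null T) (\<Sum>p\<leftarrow>xs. frag_of p)" for xs
    by (induction xs) (auto simp: quot_proj_zero quot_proj_add s_one)
  ultimately have "(\<Sum>p\<leftarrow>trep T X. frag_of p) - (\<Sum>p\<leftarrow>trep T Y. frag_of p) \<in> null T"
    by (simp add: pair_def flip: quot_proj_eq_iff[OF N])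
  then have "tcls T (trep T X) = tcls T (trep T Y)"
    by (simp add: tcls_eq_iff[OF N])
  then show ?thesis
    using trep(2)[OF X] trep(2)[OF Y] by simp
qed

section \<open>Hopf algebra identities under multilinear functions\<close>

text \<open>Only additivity of each \<open>sc k\<close> is asked, so that the same identities serve
  the group of test values with \<open>fsc\<close> as well as the modules \<open>V\<close> and
  \<open>C\<close> with their own scalars.\<close>

locale hopf_target = hopf_algebra H
  for H :: "('k::comm_ring_1, 'h::ring_1) hopf" +
  fixes sc :: "'k \<Rightarrow> 'b::ab_group_add \<Rightarrow> 'b"
  assumes sc_add: "\<And>k x y. sc k (x + y) = sc k x + sc k y"
begin

definition lin :: "('h \<Rightarrow> 'b) \<Rightarrow> bool" where
  "lin f \<longleftrightarrow> (\<forall>x y. f (x + y) = f x + f y) \<and> (\<forall>k x. f (hscale H k x) = sc k (f x))"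

definition bil :: "('h \<Rightarrow> 'h \<Rightarrow> 'b) \<Rightarrow> bool" where
  "bil g \<longleftrightarrow> (\<forall>b. lin (\<lambda>a. g a b)) \<and> (\<forall>a. lin (\<lambda>b. g a b))"

definition tri :: "('h \<Rightarrow> 'h \<Rightarrow> 'h \<Rightarrow> 'b) \<Rightarrow> bool" where
  "tri g \<longleftrightarrow> (\<forall>b c. lin (\<lambda>a. g a b c)) \<and> (\<forall>a c. lin (\<lambda>b. g a b c)) \<and> (\<forall>a b. lin (\<lambda>c. g a b c))"

abbreviation D :: "'h \<Rightarrow> ('h \<times> 'h) list" where
  "D x \<equiv> trep (HH H) (coprod H x)"

lemma sc_sum2: "sc k (sum2 xs g) = sum2 xs (\<lambda>a b. sc k (g a b))"
  by (rule sum2_hom) (rule sc_add)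

lemma lin_sum2: "lin f \<Longrightarrow> f (sum2 xs g) = sum2 xs (\<lambda>a b. f (g a b))"
  by (rule sum2_hom) (simp add: lin_def)

lemma bil_bilin: "bil g \<Longrightarrow> bilin (\<lambda>x k. hscale H k x) UNIV (hscale H) UNIV g"
  by (simp add: bil_def lin_def bilin_def)

lemma sum2_trep_tcls: "bil g \<Longrightarrow> sum2 (trep (HH H) (tcls (HH H) xs)) g = sum2 xs g"
  using pair_tcls[OF bil_bilin, of g xs] by (simp add: HH_def pair_def)

lemma coprod_in_tspace: "coprod H x \<in> tspace (HH H)"
  using coprod_linear by (simp add: linear_to_tensor_def)

lemma D_add: "bil g \<Longrightarrow> sum2 (D (x + y)) g = sum2 (D x) g + sum2 (D y) g"
  using pair_add[OF bil_bilin, of g "coprod H x" "coprod H y"] coprod_in_tspace coprod_linear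
  by (simp add: linear_to_tensor_def HH_def pair_def)

lemma D_scale:
  assumes "bil g"
  shows "sum2 (D (hscale H k x)) g = sc k (sum2 (D x) g)"
proof -
  have "sum2 (D (hscale H k x)) g = sum2 (map (\<lambda>(m, n). (hscale H k m, n)) (D x)) g"
    using coprod_linear by (simp add: linear_to_tensor_def tscale_def sum2_trep_tcls[OF assms])
  also have "\<dots> = sum2 (D x) (\<lambda>a b. g (hscale H k a) b)"
    by (simp add: sum2_def case_prod_unfold o_def)
  also have "\<dots> = sc k (sum2 (D x) g)"
    using assms by (simp add: sc_sum2 bil_def lin_def)
  finally show ?thesis .
qed

lemma D_mult:
  "bil g \<Longrightarrow> sum2 (D (x * y)) g = sum2 (D x) (\<lambda>a b. sum2 (D y) (\<lambda>c d. g (a * c) (b * d)))"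
  unfolding coprod_mult hh_mult_def
  by (simp only: sum2_trep_tcls) (simp add: sum2_def sum_list_concat_map case_prod_unfold o_def)

lemma D_one: "bil g \<Longrightarrow> sum2 (D 1) g = g 1 1"
  by (simp add: coprod_one hh_one_def sum2_trep_tcls)

lemma counit1: "lin f \<Longrightarrow> sum2 (D x) (\<lambda>a b. sc (counit H a) (f b)) = f x"
  using lin_sum2[of f "D x" "\<lambda>a b. hscale H (counit H a) b"] counit_left[of x]
  by (simp add: lin_def sum2_def)

lemma antipode1: "lin f \<Longrightarrow> sum2 (D x) (\<lambda>a b. f (antipode H a * b)) = sc (counit H x) (f 1)"
  using lin_sum2[of f "D x" "\<lambda>a b. antipode H a * b"] antipode_left[of x]
  by (simp add: lin_def sum2_def)

lemma antipode2: "lin f \<Longrightarrow> sum2 (D x) (\<lambda>a b. f (a * antipode H b)) = sc (counit H x) (f 1)"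
  using lin_sum2[of f "D x" "\<lambda>a b. a * antipode H b"] antipode_right[of x]
  by (simp add: lin_def sum2_def)

lemma counit2: "lin f \<Longrightarrow> sum2 (D x) (\<lambda>a b. sc (counit H b) (f a)) = f x"
  using lin_sum2[of f "D x" "\<lambda>a b. hscale H (counit H b) a"] counit_right[of x]
  by (simp add: lin_def sum2_def)

definition sum3 :: "('h \<times> 'h \<times> 'h) tensor \<Rightarrow> ('h \<Rightarrow> 'h \<Rightarrow> 'h \<Rightarrow> 'b) \<Rightarrow> 'b" where
  "sum3 X g = tval (HHH H) (\<lambda>(a, b, c). g a b c) X"

lemma tri_balanced:
  assumes "tri g"
  shows "balanced (HHH H) (\<lambda>(a, b, c). g a b c)"
proof (rule balancedI)
  show "null (HHH H) = generated_subgroup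
       ({frag_of (a + a', b, c) - frag_of (a, b, c) - frag_of (a', b, c) | a a' b c. True} \<union>
        {frag_of (a, b + b', c) - frag_of (a, b, c) - frag_of (a, b', c) | a b b' c. True} \<union>
        {frag_of (a, b, c + c') - frag_of (a, b, c) - frag_of (a, b, c') | a b c c'. True} \<union>
        {frag_of (hscale H k a, b, c) - frag_of (a, hscale H k b, c) | k a b c. True} \<union>
        {frag_of (a, hscale H k b, c) - frag_of (a, b, hscale H k c) | k a b c. True})"
    (is "_ = generated_subgroup ?S")
    by (simp add: HHH_def)
  let ?g = "\<lambda>(a, b, c). g a b c"
  fix x assume "x \<in> ?S"
  then consider
      a a' b c where "x = frag_of (a + a', b, c) - frag_of (a, b, c) - frag_of (a', b, c)"
    | a b b' c where "x = frag_of (a, b + b', c) - frag_of (a, b, c) - frag_of (a, b', c)"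
    | a b c c' where "x = frag_of (a, b, c + c') - frag_of (a, b, c) - frag_of (a, b, c')"
    | k a b c where "x = frag_of (hscale H k a, b, c) - frag_of (a, hscale H k b, c)"
    | k a b c where "x = frag_of (a, hscale H k b, c) - frag_of (a, b, hscale H k c)"
    by auto
  then show "\<exists>ps ns. x = (\<Sum>p\<leftarrow>ps. frag_of p) - (\<Sum>p\<leftarrow>ns. frag_of p) \<and>
     (\<Sum>p\<leftarrow>ps. ?g p) = (\<Sum>p\<leftarrow>ns. ?g p)"
  proof cases
    case 1
    show ?thesis
      using 1 assms
      by (intro exI[of _ "[(a + a', b, c)]"] exI[of _ "[(a, b, c), (a', b, c)]"]) (auto simp: tri_def lin_def)
  next
    case 2
    show ?thesis
      using 2 assms
      by (intro exI[of _ "[(a, b + b', c)]"] exI[of _ "[(a, b, c), (a, b', c)]"]) (auto simp: tri_def lin_def)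
  next
    case 3
    show ?thesis
      using 3 assms
      by (intro exI[of _ "[(a, b, c + c')]"] exI[of _ "[(a, b, c), (a, b, c')]"]) (auto simp: tri_def lin_def)
  next
    case 4
    show ?thesis
      using 4 assms
      by (intro exI[of _ "[(hscale H k a, b, c)]"] exI[of _ "[(a, hscale H k b, c)]"]) (auto simp: tri_def lin_def)
  next
    case 5
    show ?thesis
      using 5 assms
      by (intro exI[of _ "[(a, hscale H k b, c)]"] exI[of _ "[(a, b, hscale H k c)]"]) (auto simp: tri_def lin_def)
  qed
qed

lemma sum3_tcls: "tri g \<Longrightarrow> sum3 (tcls (HHH H) xs) g = (\<Sum>(a, b, c)\<leftarrow>xs. g a b c)"
  unfolding sum3_def
  by (rule tval_tcls) (simp_all add: tri_balanced, simp_all add: HHH_def is_subgroup_generated)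

lemma sum3_coprod_id:
  "tri g \<Longrightarrow> sum3 (coprod_id H X) g = sum2 (trep (HH H) X) (\<lambda>a b. sum2 (D a) (\<lambda>x y. g x y b))"
  by (simp add: coprod_id_def sum3_tcls sum2_def sum_list_concat_map case_prod_unfold o_def)

lemma sum3_id_coprod:
  "tri g \<Longrightarrow> sum3 (id_coprod H X) g = sum2 (trep (HH H) X) (\<lambda>a b. sum2 (D b) (\<lambda>x y. g a x y))"
  by (simp add: id_coprod_def sum3_tcls sum2_def sum_list_concat_map case_prod_unfold o_def)

lemma sum3_tensor_one: "tri g \<Longrightarrow> sum3 (tensor_one H X) g = sum2 (trep (HH H) X) (\<lambda>a b. g a b 1)"
  by (simp add: tensor_one_def sum3_tcls sum2_def case_prod_unfold o_def)

lemma sum3_one_tensor: "tri g \<Longrightarrow> sum3 (one_tensor H X) g = sum2 (trep (HH H) X) (\<lambda>a b. g 1 a b)"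
  by (simp add: one_tensor_def sum3_tcls sum2_def case_prod_unfold o_def)

lemma sum3_mult: "tri g \<Longrightarrow> sum3 (hhh_mult H X Y) g =
    sum3 X (\<lambda>a b c. sum3 Y (\<lambda>a' b' c'. g (a * a') (b * b') (c * c')))"
  unfolding hhh_mult_def sum3_tcls unfolding sum3_def tval_def
  by (simp add: sum2_def sum_list_concat_map case_prod_unfold o_def)

lemma sum3_add: "sum3 X (\<lambda>a b c. f a b c + g a b c) = sum3 X f + sum3 X g"
  by (simp add: sum3_def tval_def case_prod_unfold sum_list_addf)

lemma sc_sum3: "sc k (sum3 X g) = sum3 X (\<lambda>a b c. sc k (g a b c))"
proof -
  have "sc k 0 = 0"
    by (metis add_cancel_right_right sc_add)
  then have "sc k (sum_list (map f xs)) = (\<Sum>x\<leftarrow>xs. sc k (f x))" for f and xs :: "('h \<times> 'h \<times> 'h) list"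
    by (induction xs) (simp_all add: sc_add)
  then show ?thesis
    by (simp add: sum3_def tval_def case_prod_unfold)
qed

lemma D_coassoc:
  "tri g \<Longrightarrow> sum2 (D x) (\<lambda>a c. sum2 (D a) (\<lambda>u v. g u v c)) = sum2 (D x) (\<lambda>a b. sum2 (D b) (\<lambda>u v. g a u v))"
  using coassoc[of x] by (metis sum3_coprod_id sum3_id_coprod)

lemma antipode_add: "antipode H (x + y) = antipode H x + antipode H y"
  and antipode_scale: "antipode H (hscale H k x) = hscale H k (antipode H x)"
  using antipode_linear by (simp_all add: module_hom_def module_hom_axioms_def)

lemma counit_add: "counit H (x + y) = counit H x + counit H y"
  and counit_scale: "counit H (hscale H k x) = k * counit H x"
  using counit_linear by (simp_all add: module_hom_def module_hom_axioms_def)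

lemmas multilinear_simps = lin_def bil_def tri_def sum2_add sc_add
  distrib_left distrib_right antipode_add antipode_scale D_add D_scale
  scale_mult_left[symmetric] scale_mult_right[symmetric]
  sc_sum2[symmetric] sc_sum3[symmetric] sum3_add

section \<open>The adjoint action on operators\<close>

definition conv :: "('h \<Rightarrow> 'h \<Rightarrow> 'b) \<Rightarrow> 'h \<Rightarrow> 'h \<Rightarrow> 'b" where
  "conv q x y = sum2 (D x) (\<lambda>a b. q a (antipode H b * y))"

lemma bil_conv: "bil q \<Longrightarrow> bil (conv q)"
  by (simp add: conv_def multilinear_simps)

text \<open>\<open>conv q\<close> is \<open>q\<close> composed with the inverse of \<open>\<xi> \<otimes> \<eta> \<mapsto> \<xi>\<^sub>1 \<otimes> \<xi>\<^sub>2 \<eta>\<close>.\<close>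

lemma conv_unique:
  assumes L: "bil L" and q: "\<And>x y. sum2 (D x) (\<lambda>a b. L a (b * y)) = q x y"
  shows "conv q x y = L x y"
proof -
  have "conv q x y = sum2 (D x) (\<lambda>a b. sum2 (D a) (\<lambda>u v. L u (v * (antipode H b * y))))"
    by (simp add: conv_def q)
  also have "\<dots> = sum2 (D x) (\<lambda>u b. sum2 (D b) (\<lambda>v b. L u (v * (antipode H b * y))))"
    by (rule D_coassoc) (use L in \<open>simp add: multilinear_simps\<close>)
  also have "\<dots> = sum2 (D x) (\<lambda>u b. sum2 (D b) (\<lambda>v b. L u ((v * antipode H b) * y)))"
    by (simp add: mult.assoc)
  \<comment> \<open>After coassociativity the product \<xi>_2 S(\<xi>_3) stands inside the second
    argument and collapses to the counit.\<close>
  also have "\<dots> = sum2 (D x) (\<lambda>u b. sc (counit H b) (L u (1 * y)))"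
    by (subst antipode2) (use L in \<open>simp_all add: multilinear_simps\<close>)
  also have "\<dots> = L x (1 * y)"
    by (rule counit2) (use L in \<open>simp add: multilinear_simps\<close>)
  finally show ?thesis by simp
qed

text \<open>The other composite of the two mutually inverse maps; this time it is S(\<xi>_2) \<xi>_3
  that collapses.\<close>

lemma conv_inverse:
  assumes q: "bil q"
  shows "sum2 (D x) (\<lambda>a b. conv q a (b * y)) = q x y"
proof -
  have "sum2 (D x) (\<lambda>a b. conv q a (b * y)) =
      sum2 (D x) (\<lambda>a b. sum2 (D a) (\<lambda>u v. q u (antipode H v * (b * y))))"
    by (simp add: conv_def)
  also have "\<dots> = sum2 (D x) (\<lambda>u b. sum2 (D b) (\<lambda>v b. q u (antipode H v * (b * y))))"
    by (rule D_coassoc) (use q in \<open>simp add: multilinear_simps\<close>)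
  also have "\<dots> = sum2 (D x) (\<lambda>u b. sum2 (D b) (\<lambda>v b. q u ((antipode H v * b) * y)))"
    by (simp add: mult.assoc)
  also have "\<dots> = sum2 (D x) (\<lambda>u b. sc (counit H b) (q u (1 * y)))"
    by (subst antipode1) (use q in \<open>simp_all add: multilinear_simps\<close>)
  also have "\<dots> = q x (1 * y)"
    by (rule counit2) (use q in \<open>simp add: multilinear_simps\<close>)
  finally show ?thesis by simp
qed

text \<open>Equivariance of evaluation: acting with \<open>x\<close> on the value of a transformed
  operator acts with \<open>x_1\<close> on the operator and with \<open>x_2\<close> on its argument.
  By uniqueness it may be tested after composition with \<xi> \<otimes> \<eta> \<mapsto> \<xi>_1
  \<otimes> \<xi>_2 \<eta>; multiplicativity of \<Delta> then reduces it to
  \<open>conv_inverse\<close> at \<open>x * a\<close>.\<close>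

lemma conv_mult:
  assumes q: "bil q"
  shows "sum2 (D x) (\<lambda>u v. conv q (u * a) (v * y)) = conv (\<lambda>b. q (x * b)) a y"
proof (rule conv_unique[symmetric])
  show "bil (\<lambda>a y. sum2 (D x) (\<lambda>u v. conv q (u * a) (v * y)))"
    using bil_conv[OF q] by (simp add: multilinear_simps)
  fix a y
  have "sum2 (D a) (\<lambda>c d. sum2 (D x) (\<lambda>u v. conv q (u * c) (v * (d * y)))) =
      sum2 (D (x * a)) (\<lambda>c d. conv q c (d * y))"
    using bil_conv[OF q] by (subst sum2_swap, subst D_mult) (simp_all add: multilinear_simps mult.assoc)
  also have "\<dots> = q (x * a) y"
    by (rule conv_inverse[OF q])
  finally show "sum2 (D a) (\<lambda>c d. sum2 (D x) (\<lambda>u v. conv q (u * c) (v * (d * y)))) = q (x * a) y" .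
qed

end

section \<open>Twists\<close>

lemma sum2_move_in:
  "sum2 X (\<lambda>a b. sum2 Y (\<lambda>c d. sum2 (W c d) (\<lambda>e f. g a b c d e f))) =
   sum2 Y (\<lambda>c d. sum2 (W c d) (\<lambda>e f. sum2 X (\<lambda>a b. g a b c d e f)))"
  by (simp only: sum2_swap[of X Y] sum2_swap[of X "W _ _"])

lemma sum2_move_out:
  "sum2 X (\<lambda>u v. sum2 Y (\<lambda>f f'. sum2 Z (\<lambda>x y. sum2 (W x y) (\<lambda>a b. g u v f f' x y a b)))) =
   sum2 Z (\<lambda>x y. sum2 X (\<lambda>u v. sum2 (W x y) (\<lambda>a b. sum2 Y (\<lambda>f f'. g u v f f' x y a b))))"
  by (simp only: sum2_swap[of Y Z] sum2_swap[of X Z] sum2_swap[of Y "W _ _"])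

context hopf_target
begin

lemma sum2_hh_mult: "bil g \<Longrightarrow> sum2 (trep (HH H) (hh_mult H X Y)) g =
    sum2 (trep (HH H) X) (\<lambda>a b. sum2 (trep (HH H) Y) (\<lambda>c d. g (a * c) (b * d)))"
  unfolding hh_mult_def
  by (simp only: sum2_trep_tcls) (simp add: sum2_def sum_list_concat_map case_prod_unfold o_def)

lemma sum2_hh_one: "bil g \<Longrightarrow> sum2 (trep (HH H) (hh_one H)) g = g 1 1"
  by (simp add: hh_one_def sum2_trep_tcls)

lemma sum2_inverse:
  assumes "bil g" "hh_mult H X Y = hh_one H"
  shows "sum2 (trep (HH H) X) (\<lambda>a b. sum2 (trep (HH H) Y) (\<lambda>c d. g (a * c) (b * d))) = g 1 1"
  using assms by (metis sum2_hh_mult sum2_hh_one)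

text \<open>The argument Y = Y(FX) = (YF)X = X, carried out under \<open>g\<close>, where
  associativity is that of the product of \<open>H\<close>.\<close>

lemma sum2_inverse_unique:
  assumes g: "bil g" and "hh_mult H F X = hh_one H" "hh_mult H Y F = hh_one H"
  shows "sum2 (trep (HH H) X) g = sum2 (trep (HH H) Y) g"
proof -
  have "sum2 (trep (HH H) Y) g = sum2 (trep (HH H) Y) (\<lambda>a b. g (a * 1) (b * 1))"
    by simp
  also have "\<dots> = sum2 (trep (HH H) Y) (\<lambda>a b. sum2 (trep (HH H) F) (\<lambda>c d.
       sum2 (trep (HH H) X) (\<lambda>e f. g (a * (c * e)) (b * (d * f)))))"
    by (subst sum2_inverse[OF _ assms(2)]) (use g in \<open>simp_all add: multilinear_simps\<close>)
  also have "\<dots> = sum2 (trep (HH H) Y) (\<lambda>a b. sum2 (trep (HH H) F) (\<lambda>c d.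
       sum2 (trep (HH H) X) (\<lambda>e f. g ((a * c) * e) ((b * d) * f))))"
    by (simp add: mult.assoc)
  also have "\<dots> = sum2 (trep (HH H) X) (\<lambda>e f. g (1 * e) (1 * f))"
    by (subst sum2_inverse[OF _ assms(3)]) (use g in \<open>simp_all add: multilinear_simps\<close>)
  finally show ?thesis by simp
qed

end

lemma hopf_target_fsc: "hopf_algebra H \<Longrightarrow> hopf_target H fsc"
  by (simp add: hopf_target_def hopf_target_axioms_def fsc_def plus_fun_def)

context hopf_algebra
begin

text \<open>Ensures that the definite description in \<open>fbar\<close> denotes the inverse of the
  twist.\<close>

lemma hh_inverse_unique:
  assumes X: "hh_inverse_of H F X" and Y: "hh_inverse_of H F Y"
  shows "X = Y"
proof (rule tensor_eqI[where s = "hscale H"])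
  show "HH H = tensor_prod (\<lambda>x k. hscale H k x) UNIV (hscale H) UNIV"
    by (rule HH_def)
  show "X \<in> tspace (HH H)" "Y \<in> tspace (HH H)"
    using X Y by (simp_all add: hh_inverse_of_def)
  fix g :: "'h \<Rightarrow> 'h \<Rightarrow> 'k \<Rightarrow> ('h \<times> 'h \<Rightarrow>\<^sub>0 int) allquot"
  interpret hopf_target H "fsc :: _ \<Rightarrow> ('k \<Rightarrow> ('h \<times> 'h \<Rightarrow>\<^sub>0 int) allquot) \<Rightarrow> _"
    by (rule hopf_target_fsc) (rule hopf_algebra_axioms)
  assume "bilin (\<lambda>x k. hscale H k x) UNIV (hscale H) UNIV g"
    and "\<And>k m n. n \<in> UNIV \<Longrightarrow> g (hscale H k m) n = fsc k (g m n)"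
  then have "bil g"
    by (simp add: bil_def lin_def bilin_def)
  then show "pair (HH H) g X = pair (HH H) g Y"
    unfolding pair_def by (rule sum2_inverse_unique[where F = F]) (use X Y in \<open>simp_all add: hh_inverse_of_def\<close>)
qed (simp_all add: module.scale_right_distrib[OF module] module.scale_scale[OF module]
    module.scale_one[OF module] mult.commute)

end

locale twisted_target = hopf_target H sc
  for H :: "('k::comm_ring_1, 'h::ring_1) hopf"
    and sc :: "'k \<Rightarrow> 'b::ab_group_add \<Rightarrow> 'b" +
  fixes F :: "('h \<times> 'h) tensor"
  assumes twist: "twist H F"
begin

abbreviation Fs :: "('h \<times> 'h) list" where "Fs \<equiv> trep (HH H) F"

abbreviation Gs :: "('h \<times> 'h) list" where "Gs \<equiv> fbar H F"

lemma fbar_inverse: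
  obtains G where "hh_mult H F G = hh_one H" "hh_mult H G F = hh_one H" "Gs = trep (HH H) G"
proof -
  obtain G where G: "hh_inverse_of H F G"
    using twist unfolding twist_def by (elim conjE exE)
  have "(THE G. hh_inverse_of H F G) = G"
    by (rule the_equality, rule G, rule hh_inverse_unique, assumption, rule G)
  then show ?thesis
    using G by (intro that[of G]) (simp_all only: fbar_def hh_inverse_of_def)
qed

lemma F_G:
  assumes "bil g"
  shows "sum2 Fs (\<lambda>a b. sum2 Gs (\<lambda>c d. g (a * c) (b * d))) = g 1 1"
proof -
  obtain G where "hh_mult H F G = hh_one H" "Gs = trep (HH H) G"
    by (rule fbar_inverse)
  then show ?thesis
    using sum2_inverse[OF assms, of F G] by simp
qed

lemma G_F:
  assumes "bil g"
  shows "sum2 Gs (\<lambda>a b. sum2 Fs (\<lambda>c d. g (a * c) (b * d))) = g 1 1"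
proof -
  obtain G where "hh_mult H G F = hh_one H" "Gs = trep (HH H) G"
    by (rule fbar_inverse)
  then show ?thesis
    using sum2_inverse[OF assms, of G F] by simp
qed

lemma F_counit1:
  assumes "lin f"
  shows "sum2 Fs (\<lambda>a b. sc (counit H a) (f b)) = f 1"
proof -
  have "sum2 Fs (\<lambda>a b. hscale H (counit H a) b) = 1"
    using twist by (simp only: twist_def sum2_def)
  then show ?thesis
    using lin_sum2[OF assms, of Fs "\<lambda>a b. hscale H (counit H a) b"] assms by (simp add: lin_def)
qed

lemma F_counit2:
  assumes "lin f"
  shows "sum2 Fs (\<lambda>a b. sc (counit H b) (f a)) = f 1"
proof -
  have "sum2 Fs (\<lambda>a b. hscale H (counit H b) a) = 1"
    using twist by (simp only: twist_def sum2_def)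
  then show ?thesis
    using lin_sum2[OF assms, of Fs "\<lambda>a b. hscale H (counit H b) a"] assms by (simp add: lin_def)
qed

lemma lin_scale: "lin f \<Longrightarrow> f (hscale H k x) = sc k (f x)"
  by (simp add: lin_def)

lemma counit_lin:
  assumes "lin f"
  shows "lin (\<lambda>x. f (hscale H (counit H x) y))" "lin (\<lambda>y. f (hscale H (counit H x) y))"
proof -
  have "hscale H (counit H (x + x')) y = hscale H (counit H x) y + hscale H (counit H x') y"
    "hscale H (counit H (hscale H k x)) y = hscale H k (hscale H (counit H x) y)" for k x x'
    by (simp_all add: counit_add counit_scale module.scale_left_distrib[OF module] module.scale_scale[OF module])
  then show "lin (\<lambda>x. f (hscale H (counit H x) y))"
    using assms unfolding lin_def by metis
  have "hscale H (counit H x) (y + y') = hscale H (counit H x) y + hscale H (counit H x) y'"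
    "hscale H (counit H x) (hscale H k y) = hscale H k (hscale H (counit H x) y)" for k y y'
    by (rule module.scale_right_distrib[OF module], rule module.scale_left_commute[OF module])
  then show "lin (\<lambda>y. f (hscale H (counit H x) y))"
    using assms unfolding lin_def by metis
qed

lemma sc_lin_scale: "lin f \<Longrightarrow> sc k (f (hscale H k' z)) = f (hscale H (k' * k) z)"
  using lin_scale[of f k "hscale H k' z"] by (simp add: module.scale_scale[OF module] mult.commute)

text \<open>Since \<epsilon> is multiplicative, \<epsilon> \<otimes> id sends GF = 1 to a product
  whose right factor is 1 by normalisation of the twist; so the left factor is 1 too. The proof
  inserts that right factor and then cancels GF.\<close>

lemma G_counit1:
  assumes f: "lin f"
  shows "sum2 Gs (\<lambda>a b. sc (counit H a) (f b)) = f 1"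
proof -
  have "sum2 Gs (\<lambda>a b. sc (counit H a) (f b)) = sum2 Gs (\<lambda>a b. f (hscale H (counit H a) b))"
    using f by (simp add: lin_def)
  also have "\<dots> = sum2 Gs (\<lambda>a b. sum2 Fs (\<lambda>c d. sc (counit H c) (f (hscale H (counit H a) (b * d)))))"
    by (subst F_counit1) (use f counit_lin[OF f] in \<open>simp_all add: lin_def distrib_left flip: scale_mult_right\<close>)
  also have "\<dots> = sum2 Gs (\<lambda>a b. sum2 Fs (\<lambda>c d. f (hscale H (counit H (a * c)) (b * d))))"
    by (simp only: counit_mult sc_lin_scale[OF f])
  also have "\<dots> = f 1"
    by (subst G_F) (use counit_lin[OF f] in \<open>simp_all add: bil_def counit_one module.scale_one[OF module]\<close>)
  finally show ?thesis .
qed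

lemma G_counit2:
  assumes f: "lin f"
  shows "sum2 Gs (\<lambda>a b. sc (counit H b) (f a)) = f 1"
proof -
  have "sum2 Gs (\<lambda>a b. sc (counit H b) (f a)) = sum2 Gs (\<lambda>a b. f (hscale H (counit H b) a))"
    using f by (simp add: lin_def)
  also have "\<dots> = sum2 Gs (\<lambda>a b. sum2 Fs (\<lambda>c d. sc (counit H d) (f (hscale H (counit H b) (a * c)))))"
    by (subst F_counit2) (use f counit_lin[OF f] in \<open>simp_all add: lin_def distrib_left flip: scale_mult_right\<close>)
  also have "\<dots> = sum2 Gs (\<lambda>a b. sum2 Fs (\<lambda>c d. f (hscale H (counit H (b * d)) (a * c))))"
    by (simp only: counit_mult sc_lin_scale[OF f])
  also have "\<dots> = f 1"
    by (subst G_F) (use counit_lin[OF f] in \<open>simp_all add: bil_def counit_one module.scale_one[OF module]\<close>)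
  finally show ?thesis .
qed

section \<open>The cocycle identity for the twist and for its inverse\<close>

lemma F_cocycle:
  assumes g: "tri g"
  shows "sum2 Fs (\<lambda>a b. sum2 (D a) (\<lambda>u v. sum2 Fs (\<lambda>f f'. g (f * u) (f' * v) b))) =
    sum2 Fs (\<lambda>a b. sum2 (D b) (\<lambda>u v. sum2 Fs (\<lambda>f f'. g a (f * u) (f' * v))))"
proof -
  have "sum3 (hhh_mult H (tensor_one H F) (coprod_id H F)) g =
      sum2 Fs (\<lambda>f f'. sum2 Fs (\<lambda>a b. sum2 (D a) (\<lambda>u v. g (f * u) (f' * v) b)))"
    using g by (simp add: sum3_mult sum3_tensor_one sum3_coprod_id multilinear_simps)
  moreover have "sum3 (hhh_mult H (one_tensor H F) (id_coprod H F)) g =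
      sum2 Fs (\<lambda>f f'. sum2 Fs (\<lambda>a b. sum2 (D b) (\<lambda>u v. g a (f * u) (f' * v))))"
    using g by (simp add: sum3_mult sum3_one_tensor sum3_id_coprod multilinear_simps)
  moreover have "sum3 (hhh_mult H (tensor_one H F) (coprod_id H F)) g =
      sum3 (hhh_mult H (one_tensor H F) (id_coprod H F)) g"
    using twist by (simp add: twist_def)
  ultimately show ?thesis
    unfolding sum2_move_in by simp
qed

text \<open>In H \<otimes> H \<otimes> H let Z and Z' be the two sides of the cocycle identity of F,
  and put U = (\<Delta> \<otimes> id)(G) (G \<otimes> 1) and U' = (id \<otimes> \<Delta>)(G) (1
  \<otimes> G). Then ZU = 1 and U'Z' = 1, so Z = Z' gives U' = U'ZU = U'Z'U = U. Each of these
  elements is represented by the functional that evaluates \<open>g\<close> on it.\<close>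

lemma G_cocycle:
  assumes g: "tri g"
  shows "sum2 Gs (\<lambda>x y. sum2 (D x) (\<lambda>a b. sum2 Gs (\<lambda>x' y'. g (a * x') (b * y') y))) =
    sum2 Gs (\<lambda>x y. sum2 (D y) (\<lambda>a b. sum2 Gs (\<lambda>x' y'. g x (a * x') (b * y'))))"
proof -
  define Z where "Z g = sum2 Fs (\<lambda>a b. sum2 (D a) (\<lambda>u v. sum2 Fs (\<lambda>f f'. g (f * u) (f' * v) b)))"
    for g :: "'h \<Rightarrow> 'h \<Rightarrow> 'h \<Rightarrow> 'b"
  define Z' where "Z' g = sum2 Fs (\<lambda>a b. sum2 (D b) (\<lambda>u v. sum2 Fs (\<lambda>f f'. g a (f * u) (f' * v))))"
    for g :: "'h \<Rightarrow> 'h \<Rightarrow> 'h \<Rightarrow> 'b"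
  define U where "U g = sum2 Gs (\<lambda>x y. sum2 (D x) (\<lambda>a b. sum2 Gs (\<lambda>x' y'. g (a * x') (b * y') y)))"
    for g :: "'h \<Rightarrow> 'h \<Rightarrow> 'h \<Rightarrow> 'b"
  define U' where "U' g = sum2 Gs (\<lambda>x y. sum2 (D y) (\<lambda>a b. sum2 Gs (\<lambda>x' y'. g x (a * x') (b * y'))))"
    for g :: "'h \<Rightarrow> 'h \<Rightarrow> 'h \<Rightarrow> 'b"
  have tri_U: "tri (\<lambda>a b c. U (\<lambda>a' b' c'. g (a * a') (b * b') (c * c')))"
    using g by (simp add: U_def multilinear_simps)
  have ZU: "Z (\<lambda>a b c. U (\<lambda>a' b' c'. g (a * a') (b * b') (c * c'))) = g 1 1 1" if "tri g" for g
  proof -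
    \<comment> \<open>Regrouping puts the coproducts of \<open>p\<close> and \<open>x\<close> side
      by side. They fuse to \<Delta>(px), and FG = 1 is then used twice, for the outer pair
      first.\<close>
    have "Z (\<lambda>a b c. U (\<lambda>a' b' c'. g (a * a') (b * b') (c * c'))) =
      sum2 Fs (\<lambda>p q. sum2 Gs (\<lambda>x y. sum2 (D p) (\<lambda>u v. sum2 (D x) (\<lambda>a b.
        sum2 Fs (\<lambda>f f'. sum2 Gs (\<lambda>x' y'. g (f * (u * a) * x') (f' * (v * b) * y') (q * y)))))))"
      unfolding Z_def U_def mult.assoc by (subst sum2_move_out) (rule refl)
    also have "\<dots> = sum2 Fs (\<lambda>p q. sum2 Gs (\<lambda>x y. sum2 (D (p * x)) (\<lambda>u v.
        sum2 Fs (\<lambda>f f'. sum2 Gs (\<lambda>x' y'. g (f * u * x') (f' * v * y') (q * y))))))"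
      by (subst D_mult) (use that in \<open>simp_all add: multilinear_simps\<close>)
    also have "\<dots> = sum2 (D 1) (\<lambda>u v. sum2 Fs (\<lambda>f f'. sum2 Gs (\<lambda>x' y'. g (f * u * x') (f' * v * y') 1)))"
      by (subst F_G) (use that in \<open>simp_all add: multilinear_simps\<close>)
    also have "\<dots> = sum2 Fs (\<lambda>f f'. sum2 Gs (\<lambda>x' y'. g (f * x') (f' * y') 1))"
      by (subst D_one) (use that in \<open>simp_all add: multilinear_simps\<close>)
    also have "\<dots> = g 1 1 1"
      by (subst F_G) (use that in \<open>simp_all add: multilinear_simps\<close>)
    finally show ?thesis .
  qed
  have UZ: "U' (\<lambda>a b c. Z' (\<lambda>a' b' c'. g (a * a') (b * b') (c * c'))) = g 1 1 1" if "tri g" for g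
  proof -
    \<comment> \<open>Here the undivided G and F are adjacent and cancel first; the coproducts fuse
      afterwards.\<close>
    have "U' (\<lambda>a b c. Z' (\<lambda>a' b' c'. g (a * a') (b * b') (c * c'))) =
      sum2 Gs (\<lambda>x y. sum2 Fs (\<lambda>p q. sum2 (D y) (\<lambda>a b. sum2 (D q) (\<lambda>u v.
        sum2 Gs (\<lambda>x' y'. sum2 Fs (\<lambda>f f'. g (x * p) (a * (x' * f) * u) (b * (y' * f') * v)))))))"
      unfolding Z'_def U'_def mult.assoc by (subst sum2_move_out) (rule refl)
    also have "\<dots> = sum2 Gs (\<lambda>x y. sum2 Fs (\<lambda>p q. sum2 (D y) (\<lambda>a b. sum2 (D q) (\<lambda>u v.
        g (x * p) (a * u) (b * v)))))"
      by (subst G_F) (use that in \<open>simp_all add: multilinear_simps\<close>)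
    also have "\<dots> = sum2 Gs (\<lambda>x y. sum2 Fs (\<lambda>p q. sum2 (D (y * q)) (\<lambda>a b. g (x * p) a b)))"
      by (subst D_mult) (use that in \<open>simp_all add: multilinear_simps\<close>)
    also have "\<dots> = sum2 (D 1) (\<lambda>a b. g 1 a b)"
    proof -
      \<comment> \<open>Eta-contraction leaves \<open>g\<close> applied to its first argument alone,
        so linearity in it is needed as an equation between functions.\<close>
      have "g (x + y) = (\<lambda>b c. g x b c + g y b c)" "g (hscale H k x) = (\<lambda>b c. sc k (g x b c))" for x y k
        using that by (simp_all add: fun_eq_iff tri_def lin_def)
      then show ?thesis
        by (subst G_F) (use that in \<open>simp_all add: multilinear_simps\<close>)
    qed
    also have "\<dots> = g 1 1 1"
      by (subst D_one) (use that in \<open>simp_all add: multilinear_simps\<close>)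
    finally show ?thesis .
  qed
  have Z: "Z h = Z' h" if "tri h" for h
    unfolding Z_def Z'_def by (rule F_cocycle[OF that])
  have "U' g = U' (\<lambda>a b c. g (a * 1) (b * 1) (c * 1))"
    by simp
  also have "\<dots> = U' (\<lambda>a b c. Z (\<lambda>a' b' c'. U (\<lambda>a'' b'' c''. g (a * (a' * a'')) (b * (b' * b'')) (c * (c' * c'')))))"
    by (subst ZU) (use g in \<open>simp_all add: multilinear_simps\<close>)
  also have "\<dots> = U' (\<lambda>a b c. Z' (\<lambda>a' b' c'. U (\<lambda>a'' b'' c''. g ((a * a') * a'') ((b * b') * b'') ((c * c') * c''))))"
    by (subst Z) (use g in \<open>simp_all add: multilinear_simps U_def mult.assoc\<close>)
  also have "\<dots> = U (\<lambda>a'' b'' c''. g (1 * a'') (1 * b'') (1 * c''))"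
    by (rule UZ[OF tri_U])
  finally show ?thesis
    by (simp add: U_def U'_def)
qed

end

section \<open>Connections\<close>

definition test_fun ::
  "'w set \<Rightarrow> ('k, 'h, 'w::ab_group_add) calculus \<Rightarrow> ('k, 'h, 'w, 'v::ab_group_add) rmod \<Rightarrow>
    ('k \<Rightarrow> 'b \<Rightarrow> 'b) \<Rightarrow> ('v \<Rightarrow> 'w \<Rightarrow> 'b::ab_group_add) \<Rightarrow> bool"
where
  "test_fun A C V sc g \<longleftrightarrow>
     (\<forall>v v' t. g (v + v') t = g v t + g v' t) \<and>
     (\<forall>v t t'. g v (t + t') = g v t + g v t') \<and>
     (\<forall>v t. \<forall>a\<in>A. g (ract V v a) t = g v (mult C a t)) \<and>
     (\<forall>k v t. g (mscale V k v) t = sc k (g v t))"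

lemma test_fun_bilin: "test_fun A C V sc g \<Longrightarrow> bilin (ract V) A (mult C) N g"
  by (simp add: test_fun_def bilin_def)

lemma
  assumes g: "test_fun A C V sc g"
  shows pair_tens_tcls: "set xs \<subseteq> UNIV \<times> deg C n \<Longrightarrow> pair (tens A C V n) g (tcls (tens A C V n) xs) = sum2 xs g"
    and pair_tens_add: "X \<in> tspace (tens A C V n) \<Longrightarrow> Y \<in> tspace (tens A C V n) \<Longrightarrow>
      pair (tens A C V n) g (X + Y) = pair (tens A C V n) g X + pair (tens A C V n) g Y"
    and pair_tens_tsum: "set Xs \<subseteq> tspace (tens A C V n) \<Longrightarrow>
      pair (tens A C V n) g (tsum (tens A C V n) Xs) = (\<Sum>X\<leftarrow>Xs. pair (tens A C V n) g X)"
  unfolding tens_def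
  by (fact pair_tcls[OF test_fun_bilin[OF g]] pair_add[OF test_fun_bilin[OF g]]
      pair_tsum[OF test_fun_bilin[OF g]])+

lemma subgroup_null_tens: "is_subgroup (null (tens A C V n))"
  unfolding tens_def by (rule subgroup_null_tensor_prod)

lemma gens_tens [simp]: "gens (tens A C V n) = UNIV \<times> deg C n"
  by (simp add: tens_def)

lemma trep_tens: "X \<in> tspace (tens A C V n) \<Longrightarrow> (v, t) \<in> set (trep (tens A C V n) X) \<Longrightarrow> t \<in> deg C n"
  using trep(1)[of X "tens A C V n"] by auto

lemma tcls_tens_in_tspace: "set xs \<subseteq> UNIV \<times> deg C n \<Longrightarrow> tcls (tens A C V n) xs \<in> tspace (tens A C V n)"
  by (rule tcls_in_tspace) simp

lemmas tspace_tens_add = tspace_add[OF subgroup_null_tens]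
lemmas tspace_tens_tsum = tspace_tsum[OF subgroup_null_tens]

text \<open>Stated for arbitrary records with bare degree conditions, so that it applies both to the
  original and to the deformed calculus.\<close>

lemma pair_extend_conn:
  assumes g: "test_fun A C V sc g" and X: "X \<in> tspace (tens A C V 1)"
    and N: "\<And>v. N v \<in> tspace (tens A C V 1)"
    and deg_mult: "\<And>s t. s \<in> deg C 1 \<Longrightarrow> t \<in> deg C 1 \<Longrightarrow> mult C s t \<in> deg C 2"
    and deg_diff: "\<And>t. t \<in> deg C 1 \<Longrightarrow> diff C t \<in> deg C 2"
  shows "extend_conn A C V 1 N X \<in> tspace (tens A C V 2)"
    and "pair (tens A C V 2) g (extend_conn A C V 1 N X) =
      pair (tens A C V 1) (\<lambda>v t. pair (tens A C V 1) (\<lambda>u s. g u (mult C s t)) (N v) + g v (diff C t)) X"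
proof -
  let ?Y1 = "\<lambda>v t. tcls (tens A C V 2) [(u, mult C s t). (u, s) \<leftarrow> trep (tens A C V 1) (N v)]"
  let ?Y2 = "\<lambda>v t. tcls (tens A C V 2) [(v, diff C t)]"
  have ext: "extend_conn A C V 1 N X = tsum (tens A C V 2) (map (\<lambda>(v, t). ?Y1 v t + ?Y2 v t) (trep (tens A C V 1) X))"
    by (simp only: extend_conn_def one_add_one)
  have gens: "set [(u, mult C s t). (u, s) \<leftarrow> trep (tens A C V 1) (N v)] \<subseteq> UNIV \<times> deg C 2"
    "set [(v, diff C t)] \<subseteq> UNIV \<times> deg C 2" if "(v, t) \<in> set (trep (tens A C V 1) X)" for v t
    using trep_tens[OF X that] trep_tens[OF N, of _ _ v] by (auto intro: deg_mult deg_diff)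
  have Y: "?Y1 v t \<in> tspace (tens A C V 2)" "?Y2 v t \<in> tspace (tens A C V 2)"
    if "(v, t) \<in> set (trep (tens A C V 1) X)" for v t
    using gens[OF that, THEN tcls_tens_in_tspace] by simp_all
  then have all: "set (map (\<lambda>(v, t). ?Y1 v t + ?Y2 v t) (trep (tens A C V 1) X)) \<subseteq> tspace (tens A C V 2)"
    by (auto intro: tspace_tens_add)
  show "extend_conn A C V 1 N X \<in> tspace (tens A C V 2)"
    unfolding ext by (rule tspace_tens_tsum[OF all])
  have "pair (tens A C V 2) g (extend_conn A C V 1 N X) =
      sum2 (trep (tens A C V 1) X) (\<lambda>v t. pair (tens A C V 2) g (?Y1 v t + ?Y2 v t))"
    unfolding ext pair_tens_tsum[OF g all] by (simp add: sum2_def case_prod_unfold o_def)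
  also have "\<dots> = sum2 (trep (tens A C V 1) X)
      (\<lambda>v t. pair (tens A C V 1) (\<lambda>u s. g u (mult C s t)) (N v) + g v (diff C t))"
  proof (rule sum2_cong)
    fix v t assume vt: "(v, t) \<in> set (trep (tens A C V 1) X)"
    have "pair (tens A C V 2) g (?Y1 v t) = pair (tens A C V 1) (\<lambda>u s. g u (mult C s t)) (N v)"
      by (subst pair_tens_tcls[OF g gens(1)[OF vt]]) (simp add: pair_def sum2_def case_prod_unfold o_def)
    moreover have "pair (tens A C V 2) g (?Y2 v t) = g v (diff C t)"
      unfolding pair_tens_tcls[OF g gens(2)[OF vt]] by simp
    ultimately show "pair (tens A C V 2) g (?Y1 v t + ?Y2 v t) =
        pair (tens A C V 1) (\<lambda>u s. g u (mult C s t)) (N v) + g v (diff C t)"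
      by (simp add: pair_tens_add[OF g Y[OF vt]])
  qed
  finally show "pair (tens A C V 2) g (extend_conn A C V 1 N X) =
      pair (tens A C V 1) (\<lambda>v t. pair (tens A C V 1) (\<lambda>u s. g u (mult C s t)) (N v) + g v (diff C t)) X"
    by (simp add: pair_def)
qed

locale calculus_setting = twisted_target H sc F +
  cal: covariant_calculus H A C + rm: module_right_module H A C V
  for H :: "('k::comm_ring_1, 'h::ring_1) hopf"
    and sc :: "'k \<Rightarrow> 'b::ab_group_add \<Rightarrow> 'b"
    and F :: "('h \<times> 'h) tensor"
    and A :: "'w::ab_group_add set"
    and C :: "('k, 'h, 'w) calculus"
    and V :: "('k, 'h, 'w, 'v::ab_group_add) rmod"
begin

abbreviation T :: "nat \<Rightarrow> ('v \<times> 'w) tprod" where "T n \<equiv> tens A C V n"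

abbreviation test :: "('v \<Rightarrow> 'w \<Rightarrow> 'b) \<Rightarrow> bool" where "test \<equiv> test_fun A C V sc"

lemma actV: "hact V x (v + w) = hact V x v + hact V x w"
  "hact V x (mscale V k v) = mscale V k (hact V x v)"
  "hact V (x + y) v = hact V x v + hact V y v"
  "hact V (hscale H k x) v = mscale V k (hact V x v)"
  using rm.act_linear[of x] rm.act_linear'[of v] by (simp_all add: module_hom_def module_hom_axioms_def)

lemma actC: "hact C x (s + t) = hact C x s + hact C x t"
  "hact C x (mscale C k s) = mscale C k (hact C x s)"
  "hact C (x + y) s = hact C x s + hact C y s"
  "hact C (hscale H k x) s = mscale C k (hact C x s)"
  using cal.A.act_linear[of x] cal.A.act_linear'[of s] by (simp_all add: module_hom_def module_hom_axioms_def)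

lemma multC: "mult C (s + s') t = mult C s t + mult C s' t"
  "mult C s (t + t') = mult C s t + mult C s t'"
  "mult C (mscale C k s) t = mscale C k (mult C s t)"
  "mult C s (mscale C k t) = mscale C k (mult C s t)"
  by (simp_all add: cal.forms.mult_add_left cal.forms.mult_add_right
      cal.forms.mult_scale_left cal.forms.mult_scale_right)

lemma diffC: "diff C (s + t) = diff C s + diff C t" "diff C (mscale C k s) = mscale C k (diff C s)"
  using cal.diff_linear by (simp_all add: module_hom_def module_hom_axioms_def)

lemma ractV: "a \<in> A \<Longrightarrow> ract V (v + w) a = ract V v a + ract V w a"
  "a \<in> A \<Longrightarrow> ract V (mscale V k v) a = mscale V k (ract V v a)"
  using rm.ract_linear[of a] by (simp_all add: module_hom_def module_hom_axioms_def)

lemma scale_closed: "a \<in> A \<Longrightarrow> mscale C k a \<in> A"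
  by (rule module.subspace_scale[OF cal.A.module cal.A.subspace])

lemma act_mult2: "hact C x (mult C s t) = sum2 (D x) (\<lambda>a b. mult C (hact C a s) (hact C b t))"
  by (simp add: cal.forms.act_mult_alg sum2_def)

lemma act_ract2: "a \<in> A \<Longrightarrow> hact V x (ract V v a) = sum2 (D x) (\<lambda>c d. ract V (hact V c v) (hact C d a))"
  by (simp add: rm.act_ract sum2_def)

text \<open>Scalars act through \<open>A\<close>, so balancedness carries linearity over the ground
  ring from the left factor of a test function to the right one.\<close>

lemma scale_by_unit: "mscale V k v = ract V v (mscale C k (unit C))" "mscale C k t = mult C (mscale C k (unit C)) t"
  by (simp_all add: rm.ract_scale cal.A.unit_closed rm.ract_unit multC cal.forms.unit_left)

lemma tstD:
  assumes "test g"
  shows "g (v + v') t = g v t + g v' t" "g v (t + t') = g v t + g v t'"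
    "g (mscale V k v) t = sc k (g v t)" "g v (mscale C k t) = sc k (g v t)"
proof -
  show "g (v + v') t = g v t + g v' t" "g v (t + t') = g v t + g v t'"
    and s: "g (mscale V k v) t = sc k (g v t)"
    using assms by (simp_all add: test_fun_def)
  have "g (ract V v (mscale C k (unit C))) t = g v (mult C (mscale C k (unit C)) t)"
    using assms scale_closed[OF cal.A.unit_closed] by (simp add: test_fun_def)
  then show "g v (mscale C k t) = sc k (g v t)"
    by (simp add: s flip: scale_by_unit)
qed

lemma test_balanced: "test g \<Longrightarrow> a \<in> A \<Longrightarrow> g (ract V v a) t = g v (mult C a t)"
  by (simp add: test_fun_def)

lemma test_sum:
  assumes "test g"
  shows "g (sum2 xs f) t = sum2 xs (\<lambda>a b. g (f a b) t)" "g v (sum2 xs h) = sum2 xs (\<lambda>a b. g v (h a b))"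
  using sum2_hom[of "\<lambda>v. g v t"] sum2_hom[of "g v"] tstD[OF assms] by simp_all

lemma test_sum2: "(\<And>a b. test (f a b)) \<Longrightarrow> test (\<lambda>v t. sum2 xs (\<lambda>a b. f a b v t))"
  by (simp add: test_fun_def sum2_add sc_sum2)

text \<open>
  The actions of \<open>x\<close> on tensors and of right multiplication by the form \<open>t\<close>, transposed to test
  functions: \<open>act_test g x\<close> and \<open>wedge_test g t\<close>.  Test functions are defined on forms of all degrees, so
  they need no index \<open>n\<close>.
\<close>

definition act_test :: "('v \<Rightarrow> 'w \<Rightarrow> 'b) \<Rightarrow> 'h \<Rightarrow> 'v \<Rightarrow> 'w \<Rightarrow> 'b" where
  "act_test g x v t = sum2 (D x) (\<lambda>a b. g (hact V a v) (hact C b t))"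

text \<open>Well-definedness of the action on tensors over \<open>A\<close>: on either side of the
  balancing relation \<xi> is distributed over \<open>v\<close>, \<open>a\<close> and
  \<open>t\<close>, and coassociativity identifies the two distributions.\<close>

lemma test_act_test:
  assumes g: "test g"
  shows "test (act_test g x)"
proof -
  have "act_test g x (ract V v a) t = act_test g x v (mult C a t)" if a: "a \<in> A" for v a t
  proof -
    have "act_test g x (ract V v a) t =
        sum2 (D x) (\<lambda>b c. sum2 (D b) (\<lambda>b d. g (hact V b v) (mult C (hact C d a) (hact C c t))))"
      by (simp add: act_test_def act_ract2 a test_sum[OF g] test_balanced[OF g] cal.A.act_closed)
    also have "\<dots> = sum2 (D x) (\<lambda>b c. sum2 (D c) (\<lambda>d c. g (hact V b v) (mult C (hact C d a) (hact C c t))))"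
      by (rule D_coassoc) (simp add: multilinear_simps actV actC multC tstD[OF g])
    also have "\<dots> = act_test g x v (mult C a t)"
      by (simp add: act_test_def act_mult2 test_sum[OF g])
    finally show ?thesis .
  qed
  then show ?thesis
    by (simp add: test_fun_def act_test_def actV actC tstD[OF g] sum2_add sc_sum2)
qed

text \<open>Transposition turns the left action on tensors into a right action on test
  functions.\<close>

lemma act_test_act_test:
  assumes g: "test g"
  shows "act_test (act_test g x) y = act_test g (x * y)"
proof (intro ext)
  fix v t
  have "act_test g (x * y) v t = sum2 (D x) (\<lambda>a b. sum2 (D y) (\<lambda>c d. g (hact V (a * c) v) (hact C (b * d) t)))"
    unfolding act_test_def by (rule D_mult) (simp add: multilinear_simps actV actC tstD[OF g])
  then show "act_test (act_test g x) y v t = act_test g (x * y) v t"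
    by (simp add: act_test_def rm.act_mult cal.A.act_mult sum2_swap[of "D x" "D y"])
qed

lemma act_test_one: "test g \<Longrightarrow> act_test g 1 = g"
  by (intro ext) (simp add: act_test_def D_one multilinear_simps actV actC tstD rm.act_one cal.A.act_one)

lemma act_test_linear:
  assumes g: "test g"
  shows "act_test g (x + y) = (\<lambda>v t. act_test g x v t + act_test g y v t)"
    and "act_test g (hscale H k x) = (\<lambda>v t. sc k (act_test g x v t))"
  by (simp_all add: fun_eq_iff act_test_def multilinear_simps actV actC tstD[OF g])

lemma act_test_fun:
  "act_test (\<lambda>v t. f v t + g v t) x = (\<lambda>v t. act_test f x v t + act_test g x v t)"
  "act_test (\<lambda>v t. sc k (f v t)) x = (\<lambda>v t. sc k (act_test f x v t))"
  "act_test (\<lambda>v t. sum2 xs (\<lambda>a b. h a b v t)) x = (\<lambda>v t. sum2 xs (\<lambda>a b. act_test (h a b) x v t))"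
  by (simp_all add: fun_eq_iff act_test_def sum2_add sc_sum2 sum2_swap[of _ xs])

lemma tens_act_in_tspace: "X \<in> tspace (T n) \<Longrightarrow> tens_act H A C V n x X \<in> tspace (T n)"
  unfolding tens_act_def by (rule tcls_tens_in_tspace) (auto dest: trep_tens cal.deg_act)

lemma pair_tens_act:
  assumes g: "test g" and X: "X \<in> tspace (T n)"
  shows "pair (T n) g (tens_act H A C V n x X) = pair (T n) (act_test g x) X"
proof -
  let ?xs = "[(hact V a v, hact C b t). (a, b) \<leftarrow> D x, (v, t) \<leftarrow> trep (T n) X]"
  have "set ?xs \<subseteq> UNIV \<times> deg C n"
    using X by (auto dest: trep_tens cal.deg_act)
  then have "pair (T n) g (tens_act H A C V n x X) = sum2 ?xs g"
    unfolding tens_act_def by (rule pair_tens_tcls[OF g])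
  also have "\<dots> = sum2 (D x) (\<lambda>a b. sum2 (trep (T n) X) (\<lambda>v t. g (hact V a v) (hact C b t)))"
    by (simp add: sum2_def sum_list_concat_map case_prod_unfold o_def)
  finally show ?thesis
    by (simp add: pair_def act_test_def[abs_def] sum2_swap[of "trep (T n) X"])
qed

definition wedge_test :: "('v \<Rightarrow> 'w \<Rightarrow> 'b) \<Rightarrow> 'w \<Rightarrow> 'v \<Rightarrow> 'w \<Rightarrow> 'b" where
  "wedge_test g t v s = g v (mult C s t)"

lemma test_wedge_test: "test g \<Longrightarrow> test (wedge_test g t)"
  by (simp add: test_fun_def wedge_test_def multC cal.forms.mult_assoc)

lemma wedge_test_linear:
  assumes g: "test g"
  shows "wedge_test g (s + t) = (\<lambda>v u. wedge_test g s v u + wedge_test g t v u)"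
    and "wedge_test g (mscale C k t) = (\<lambda>v u. sc k (wedge_test g t v u))"
  by (simp_all add: fun_eq_iff wedge_test_def multC tstD[OF g])

lemma wedge_test_fun:
  "wedge_test (\<lambda>v t. f v t + g v t) s = (\<lambda>v t. wedge_test f s v t + wedge_test g s v t)"
  "wedge_test (\<lambda>v t. sc k (f v t)) s = (\<lambda>v t. sc k (wedge_test f s v t))"
  "wedge_test (\<lambda>v t. sum2 xs (\<lambda>a b. h a b v t)) s = (\<lambda>v t. sum2 xs (\<lambda>a b. wedge_test (h a b) s v t))"
  by (simp_all add: fun_eq_iff wedge_test_def)

text \<open>Transpose of the rule x \<triangleright> (X \<and> t) = (x_1 \<triangleright> X) \<and>
  (x_2 \<triangleright> t).\<close>

lemma wedge_test_act_test:
  assumes g: "test g"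
  shows "wedge_test (act_test g x) t = (\<lambda>u s. sum2 (D x) (\<lambda>c d. act_test (wedge_test g (hact C d t)) c u s))"
proof (intro ext)
  fix u s
  have "wedge_test (act_test g x) t u s = sum2 (D x) (\<lambda>a b. sum2 (D b) (\<lambda>b c. g (hact V a u) (mult C (hact C b s) (hact C c t))))"
    by (simp add: wedge_test_def act_test_def act_mult2 test_sum[OF g])
  also have "\<dots> = sum2 (D x) (\<lambda>a c. sum2 (D a) (\<lambda>a b. g (hact V a u) (mult C (hact C b s) (hact C c t))))"
    by (rule D_coassoc[symmetric]) (simp add: multilinear_simps actV actC multC tstD[OF g])
  finally show "wedge_test (act_test g x) t u s = sum2 (D x) (\<lambda>c d. act_test (wedge_test g (hact C d t)) c u s)"
    by (simp add: wedge_test_def act_test_def)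
qed

end

locale connection_setting = calculus_setting H sc F A C V
  for H :: "('k::comm_ring_1, 'h::ring_1) hopf"
    and sc :: "'k \<Rightarrow> 'b::ab_group_add \<Rightarrow> 'b"
    and F :: "('h \<times> 'h) tensor"
    and A :: "'w::ab_group_add set"
    and C :: "('k, 'h, 'w) calculus"
    and V :: "('k, 'h, 'w, 'v::ab_group_add) rmod" +
  fixes N :: "'v \<Rightarrow> ('v \<times> 'w) tensor"
  assumes N: "N \<in> connections A C V"
begin

section \<open>The connection, its extension and their transposes\<close>

lemma N_in_tspace: "N v \<in> tspace (T 1)"
  using N by (simp add: connections_def linear_to_tensor_def)

definition conn_val :: "('v \<Rightarrow> 'w \<Rightarrow> 'b) \<Rightarrow> 'v \<Rightarrow> 'b" where
  "conn_val g v = pair (T 1) g (N v)"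

lemma conn_val_fun:
  "conn_val (\<lambda>v t. f v t + g v t) v = conn_val f v + conn_val g v"
  "conn_val (\<lambda>v t. sc k (f v t)) v = sc k (conn_val f v)"
  "conn_val (\<lambda>v t. sum2 xs (\<lambda>a b. h a b v t)) v = sum2 xs (\<lambda>a b. conn_val (h a b) v)"
  by (simp_all add: conn_val_def pair_def sum2_add sc_sum2 sum2_swap[of _ xs])

lemma conn_val_add:
  assumes g: "test g"
  shows "conn_val g (v + w) = conn_val g v + conn_val g w"
  using N by (simp add: connections_def linear_to_tensor_def conn_val_def pair_tens_add[OF g])

lemma conn_val_scale:
  assumes g: "test g"
  shows "conn_val g (mscale V k v) = sc k (conn_val g v)"
proof -
  have "N (mscale V k v) = tcls (T 1) (map (\<lambda>(m, n). (mscale V k m, n)) (trep (T 1) (N v)))"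
    using N by (simp add: connections_def linear_to_tensor_def tscale_def)
  then have "conn_val g (mscale V k v) = sum2 (map (\<lambda>(m, n). (mscale V k m, n)) (trep (T 1) (N v))) g"
    unfolding conn_val_def by (simp only:) (subst pair_tens_tcls[OF g], auto dest: trep_tens[OF N_in_tspace])
  also have "\<dots> = sum2 (trep (T 1) (N v)) (\<lambda>m n. g (mscale V k m) n)"
    by (simp add: sum2_def case_prod_unfold o_def)
  finally show ?thesis
    by (simp add: tstD[OF g] conn_val_def pair_def sc_sum2)
qed

lemma conn_val_leibniz:
  assumes g: "test g" and a: "a \<in> A"
  shows "conn_val g (ract V v a) = conn_val (wedge_test g a) v + g v (diff C a)"
proof -
  let ?xs = "[(u, mult C t a). (u, t) \<leftarrow> trep (T 1) (N v)]"
  have a0: "a \<in> deg C 0"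
    using a by (simp add: cal.deg_zero)
  have 1: "set ?xs \<subseteq> UNIV \<times> deg C 1"
    using cal.deg_mult[OF trep_tens[OF N_in_tspace] a0] by fastforce
  have 2: "set [(v, diff C a)] \<subseteq> UNIV \<times> deg C 1"
    using cal.deg_diff[OF a0] by simp
  have "N (ract V v a) = tcls (T 1) ?xs + tcls (T 1) [(v, diff C a)]"
    using N a by (simp add: connections_def)
  then have "conn_val g (ract V v a) = sum2 ?xs g + g v (diff C a)"
    by (simp add: conn_val_def pair_tens_add[OF g tcls_tens_in_tspace[OF 1] tcls_tens_in_tspace[OF 2]]
        pair_tens_tcls[OF g 1] pair_tens_tcls[OF g 2] del: set_map One_nat_def)
  then show ?thesis
    by (simp add: conn_val_def wedge_test_def pair_def sum2_def case_prod_unfold o_def)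
qed

text \<open>
  The transpose of the extended connection.
\<close>

definition ext_test :: "('v \<Rightarrow> 'w \<Rightarrow> 'b) \<Rightarrow> 'v \<Rightarrow> 'w \<Rightarrow> 'b" where
  "ext_test g v t = conn_val (wedge_test g t) v + g v (diff C t)"

text \<open>Well-definedness of the extended connection over \<open>A\<close>: the term v \<otimes>
  da \<and> t that the connection produces on \<open>v a\<close> is the one that the differential
  produces on \<open>a t\<close>.\<close>

lemma test_ext_test:
  assumes g: "test g"
  shows "test (ext_test g)"
proof -
  have "ext_test g (ract V v a) t = ext_test g v (mult C a t)" if a: "a \<in> A" for v a t
  proof -
    have "diff C (mult C a t) = mult C (diff C a) t + mult C a (diff C t)"
      using cal.diff_mult[of a 0 t] a by (simp add: cal.deg_zero module.scale_one[OF cal.A.module])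
    moreover have "wedge_test (wedge_test g t) a = wedge_test g (mult C a t)"
      by (simp add: fun_eq_iff wedge_test_def cal.forms.mult_assoc)
    ultimately show ?thesis
      by (simp add: ext_test_def conn_val_leibniz[OF test_wedge_test[OF g] a] test_balanced[OF g a] tstD[OF g])
        (simp add: wedge_test_def)
  qed
  then show ?thesis
    by (simp add: test_fun_def ext_test_def conn_val_add[OF test_wedge_test[OF g]] conn_val_scale[OF test_wedge_test[OF g]] tstD[OF g]
        wedge_test_linear[OF g] conn_val_fun diffC sc_add)
qed

lemma ext_test_fun:
  "ext_test (\<lambda>v t. f v t + g v t) = (\<lambda>v t. ext_test f v t + ext_test g v t)"
  "ext_test (\<lambda>v t. sc k (f v t)) = (\<lambda>v t. sc k (ext_test f v t))"
  by (simp_all add: fun_eq_iff ext_test_def wedge_test_fun conn_val_fun sc_add)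

lemma extend_in_tspace: "X \<in> tspace (T 1) \<Longrightarrow> extend_conn A C V 1 N X \<in> tspace (T 2)"
  and pair_extend: "X \<in> tspace (T 1) \<Longrightarrow> test g \<Longrightarrow>
    pair (T 2) g (extend_conn A C V 1 N X) = pair (T 1) (ext_test g) X"
proof -
  have m: "mult C s t \<in> deg C 2" if "s \<in> deg C 1" "t \<in> deg C 1" for s t
    using cal.deg_mult[OF that] by (simp add: one_add_one)
  have d: "diff C t \<in> deg C 2" if "t \<in> deg C 1" for t
    using cal.deg_diff[OF that] by (simp add: one_add_one)
  \<comment> \<open>The empty sum yields \<open>sc k 0 = 0\<close>, so zero is a test function; it
    is supplied in order to extract the membership part of \<open>pair_extend_conn\<close>.\<close>
  have "test_fun A C V sc (\<lambda>_ _. 0)"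
    using sc_sum2[of _ "[]" "undefined :: unit \<Rightarrow> unit \<Rightarrow> _"] by (simp add: test_fun_def)
  then show "X \<in> tspace (T 1) \<Longrightarrow> extend_conn A C V 1 N X \<in> tspace (T 2)"
    by (rule pair_extend_conn(1)) (use N_in_tspace m d in auto)
  show "pair (T 2) g (extend_conn A C V 1 N X) = pair (T 1) (ext_test g) X" if "X \<in> tspace (T 1)" "test g"
    using pair_extend_conn(2)[OF that(2,1) N_in_tspace m d] by (simp add: ext_test_def[abs_def] conn_val_def wedge_test_def[abs_def])
qed

text \<open>
  The pairing of \<open>g\<close> with \<open>x \<triangleright> \<nabla>(y \<triangleright> v)\<close>, and in \<open>ext_op\<close> with \<open>x \<triangleright> \<nabla>(y \<triangleright> (v \<otimes> t))\<close>; applying \<open>conv\<close>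
  gives the pairings with \<open>(x\<cdot>\<nabla>)(y \<triangleright> v)\<close> and \<open>(x\<cdot>\<nabla>)(y \<triangleright> (v \<otimes> t))\<close>, with \<open>x\<cdot>\<nabla>\<close> the adjoint action.
\<close>

definition conn_op :: "('v \<Rightarrow> 'w \<Rightarrow> 'b) \<Rightarrow> 'v \<Rightarrow> 'h \<Rightarrow> 'h \<Rightarrow> 'b" where
  "conn_op g v x y = conn_val (act_test g x) (hact V y v)"

lemma bil_conn_op: "test g \<Longrightarrow> bil (conn_op g v)"
  by (simp add: bil_def lin_def conn_op_def act_test_linear conn_val_fun actV conn_val_add conn_val_scale test_act_test)

lemma conv_fun:
  "conv (conn_op (\<lambda>v t. f v t + g v t) v) x y = conv (conn_op f v) x y + conv (conn_op g v) x y"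
  "conv (conn_op (\<lambda>v t. sc k (f v t)) v) x y = sc k (conv (conn_op f v) x y)"
  "conv (conn_op (\<lambda>v t. sum2 xs (\<lambda>a b. h a b v t)) v) x y = sum2 xs (\<lambda>a b. conv (conn_op (h a b) v) x y)"
  by (simp_all add: conv_def conn_op_def act_test_fun conn_val_fun sum2_add sc_sum2 sum2_swap[of _ xs])

lemma conv_conn_op_act: "conv (conn_op g (hact V z v)) x y = conv (conn_op g v) x (y * z)"
  by (simp add: conv_def conn_op_def mult.assoc flip: rm.act_mult)

lemma conv_conn_op_mult:
  assumes g: "test g"
  shows "sum2 (D x) (\<lambda>c d. conv (conn_op g v) (c * a) (d * y)) = conv (conn_op (act_test g x) v) a y"
proof -
  have "(\<lambda>b. conn_op g v (x * b)) = conn_op (act_test g x) v"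
    by (simp add: fun_eq_iff conn_op_def act_test_act_test[OF g])
  then show ?thesis
    using conv_mult[OF bil_conn_op[OF g]] by simp
qed

definition ext_op :: "('v \<Rightarrow> 'w \<Rightarrow> 'b) \<Rightarrow> 'v \<Rightarrow> 'w \<Rightarrow> 'h \<Rightarrow> 'h \<Rightarrow> 'b" where
  "ext_op g v t x y = act_test (ext_test (act_test g x)) y v t"

lemma bil_ext_op: "test g \<Longrightarrow> bil (ext_op g v t)"
  by (simp add: bil_def lin_def ext_op_def act_test_linear act_test_fun ext_test_fun test_act_test test_ext_test)

lemma lin_counit:
  assumes g: "test g"
  shows "lin (\<lambda>x. g v (mscale C (counit H x) t))"
proof -
  have "mscale C (counit H (x + y)) t = mscale C (counit H x) t + mscale C (counit H y) t"
    "mscale C (counit H (hscale H k x)) t = mscale C k (mscale C (counit H x) t)" for x y k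
    by (simp_all add: counit_add counit_scale module.scale_left_distrib[OF cal.A.module]
        module.scale_scale[OF cal.A.module])
  then show ?thesis
    unfolding lin_def using tstD[OF g] by metis
qed

text \<open>
  Comes from \<open>(x\<cdot>\<nabla>)(v \<otimes> t) = (x\<cdot>\<nabla>)(v) \<and> t + \<epsilon>(x) v \<otimes> dt\<close>.
\<close>

definition ext_kernel :: "('v \<Rightarrow> 'w \<Rightarrow> 'b) \<Rightarrow> 'v \<Rightarrow> 'w \<Rightarrow> 'h \<Rightarrow> 'h \<Rightarrow> 'h \<Rightarrow> 'b" where
  "ext_kernel g v t x a b = conv (conn_op (wedge_test g (hact C b t)) v) x a + g (hact V a v) (mscale C (counit H x) (diff C (hact C b t)))"

lemma tri_ext_kernel:
  assumes g: "test g"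
  shows "tri (ext_kernel g v t)"
proof -
  have "lin (\<lambda>x. ext_kernel g v t x a b)" for a b
    using bil_conv[OF bil_conn_op[OF test_wedge_test[OF g]]] lin_counit[OF g]
    by (simp add: ext_kernel_def bil_def lin_def sc_add)
  moreover have "lin (\<lambda>a. ext_kernel g v t x a b)" for x b
    using bil_conv[OF bil_conn_op[OF test_wedge_test[OF g]]]
    by (simp add: ext_kernel_def bil_def lin_def sc_add actV tstD(1,3)[OF g])
  moreover have "lin (\<lambda>b. ext_kernel g v t x a b)" for x a
  proof -
    have "mscale C c (diff C (hact C (b + b') t)) = mscale C c (diff C (hact C b t)) + mscale C c (diff C (hact C b' t))"
      "mscale C c (diff C (hact C (hscale H k b) t)) = mscale C k (mscale C c (diff C (hact C b t)))" for b b' c k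
      by (simp_all add: actC diffC module.scale_right_distrib[OF cal.A.module]
          module.scale_left_commute[OF cal.A.module])
    then have "lin (\<lambda>b. g (hact V a v) (mscale C (counit H x) (diff C (hact C b t))))"
      unfolding lin_def using tstD[OF g] by metis
    then show ?thesis
      by (simp add: ext_kernel_def lin_def sc_add actC wedge_test_linear[OF g] conv_fun)
  qed
  ultimately show ?thesis
    by (simp add: tri_def)
qed

text \<open>Proved by \<open>conv_unique\<close>: once \<open>x\<close> is distributed over operator
  and argument, the connection term loses its antipode by \<open>conv_inverse\<close>, the counit in
  the other term absorbs one leg of \<open>x\<close>, and what remains is \<open>x\<close> acting on
  the extended connection, since d commutes with the action.\<close>

lemma conv_ext_op:
  assumes g: "test g"
  shows "conv (ext_op g v t) x y = sum2 (D y) (ext_kernel g v t x)"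
proof (rule conv_unique)
  note tri = tri_ext_kernel[OF g, of v t]
  have "bil (ext_kernel g v t x)" for x
    using tri by (simp add: tri_def bil_def)
  then show "bil (\<lambda>x y. sum2 (D y) (ext_kernel g v t x))"
    using tri by (simp add: multilinear_simps cong: sum2_cong)
  fix x y
  have bilK: "bil (ext_kernel g v t x)" for x
    using tri by (simp add: tri_def bil_def)
  have "sum2 (D x) (\<lambda>c d. sum2 (D (d * y)) (ext_kernel g v t c)) =
     sum2 (D x) (\<lambda>c d. sum2 (D d) (\<lambda>d e. sum2 (D y) (\<lambda>a b. ext_kernel g v t c (d * a) (e * b))))"
    by (simp add: D_mult[OF bilK])
  also have "\<dots> = sum2 (D x) (\<lambda>c e. sum2 (D c) (\<lambda>c d. sum2 (D y) (\<lambda>a b. ext_kernel g v t c (d * a) (e * b))))"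
    by (rule D_coassoc[symmetric]) (use tri in \<open>simp add: multilinear_simps\<close>)
  also have "\<dots> = sum2 (D y) (\<lambda>a b. sum2 (D x) (\<lambda>c e. sum2 (D c) (\<lambda>c d. ext_kernel g v t c (d * a) (e * b))))"
    by (simp add: sum2_swap[of _ "D y"])
  also have "\<dots> = sum2 (D y) (\<lambda>a b. sum2 (D x) (\<lambda>c e. conn_op (wedge_test g (hact C (e * b) t)) v c a +
      g (hact V (c * a) v) (diff C (hact C (e * b) t))))"
  proof -
    have "sum2 (D c) (\<lambda>c d. ext_kernel g v t c (d * a) e) = conn_op (wedge_test g (hact C e t)) v c a +
        g (hact V (c * a) v) (diff C (hact C e t))" for c a e
    proof -
      have "lin (\<lambda>d. g (hact V (d * a) v) (diff C (hact C e t)))"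
        by (simp add: multilinear_simps actV tstD[OF g])
      from counit1[OF this, of c] show ?thesis
        by (simp add: ext_kernel_def sum2_add conv_inverse[OF bil_conn_op[OF test_wedge_test[OF g]]] tstD(4)[OF g])
    qed
    then show ?thesis by simp
  qed
  also have "\<dots> = ext_op g v t x y"
    by (simp add: ext_op_def act_test_def[of "ext_test _"] ext_test_def wedge_test_act_test[OF g] conn_val_fun conn_op_def act_test_def[of g] sum2_add
        cal.A.act_mult rm.act_mult cal.act_diff)
  finally show "sum2 (D x) (\<lambda>c d. sum2 (D (d * y)) (ext_kernel g v t c)) = ext_op g v t x y" .
qed

text \<open>
  The pairings of \<open>g\<close> with \<open>D(\<nabla>)(v)\<close> and with \<open>D(\<nabla>)(v \<otimes> t)\<close>.
\<close>

definition dconn_val :: "('v \<Rightarrow> 'w \<Rightarrow> 'b) \<Rightarrow> 'v \<Rightarrow> 'b" where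
  "dconn_val g v = sum2 Gs (\<lambda>x y. conv (conn_op g v) x y)"

definition dext_test :: "('v \<Rightarrow> 'w \<Rightarrow> 'b) \<Rightarrow> 'v \<Rightarrow> 'w \<Rightarrow> 'b" where
  "dext_test g v t = sum2 Gs (\<lambda>x y. conv (ext_op g v t) x y)"

lemma dconn_val_sum2: "dconn_val (\<lambda>v t. sum2 xs (\<lambda>a b. h a b v t)) v = sum2 xs (\<lambda>a b. dconn_val (h a b) v)"
  by (simp add: dconn_val_def conv_fun sum2_swap[of _ xs])

text \<open>Computes D(\<nabla>) on \<phi>(v \<otimes> t) as the image of the deformed Leibniz
  formula. The cocycle identity moves the coproduct from the second leg of the outer G, where the
  action on v \<otimes> t put it, to the first leg, where it can be absorbed by equivariance of
  evaluation.\<close>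

lemma dext_test_twisted:
  assumes g: "test g"
  shows "sum2 Gs (\<lambda>x y. dext_test g (hact V x v) (hact C y t)) =
    sum2 Gs (\<lambda>x y. dconn_val (act_test (wedge_test g (hact C y t)) x) v + g (hact V x v) (diff C (hact C y t)))"
proof -
  have "ext_kernel g (hact V x' v) (hact C y' t) x a b = ext_kernel g v t x (a * x') (b * y')" for x' y' x a b
    by (simp add: ext_kernel_def conv_conn_op_act rm.act_mult cal.A.act_mult)
  then have "sum2 Gs (\<lambda>x y. dext_test g (hact V x v) (hact C y t)) =
      sum2 Gs (\<lambda>x' y'. sum2 Gs (\<lambda>x y. sum2 (D y) (\<lambda>a b. ext_kernel g v t x (a * x') (b * y'))))"
    by (simp add: dext_test_def conv_ext_op[OF g] cong: sum2_cong)
  also have "\<dots> = sum2 Gs (\<lambda>x y. sum2 (D y) (\<lambda>a b. sum2 Gs (\<lambda>x' y'. ext_kernel g v t x (a * x') (b * y'))))"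
    by (rule sum2_move_in)
  also have "\<dots> = sum2 Gs (\<lambda>x y. sum2 (D x) (\<lambda>a b. sum2 Gs (\<lambda>x' y'. ext_kernel g v t (a * x') (b * y') y)))"
    by (rule G_cocycle[symmetric]) (rule tri_ext_kernel[OF g])
  \<comment> \<open>The first summand is ready for \<open>conv_conn_op_mult\<close>. In the second
    the counit falls on the first legs, which removes the inner G and reduces \<Delta>(x) to
    \<open>x\<close>.\<close>
  also have "\<dots> = sum2 Gs (\<lambda>x y. sum2 Gs (\<lambda>x' y'. sum2 (D x) (\<lambda>a b. conv (conn_op (wedge_test g (hact C y t)) v) (a * x') (b * y'))) +
      sum2 (D x) (\<lambda>a b. sum2 Gs (\<lambda>x' y'. g (hact V (b * y') v) (mscale C (counit H (a * x')) (diff C (hact C y t))))))"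
    by (simp add: ext_kernel_def sum2_add sum2_swap[of "D _" Gs])
  also have "\<dots> = sum2 Gs (\<lambda>x y. dconn_val (act_test (wedge_test g (hact C y t)) x) v + g (hact V x v) (diff C (hact C y t)))"
  proof -
    have "sum2 (D x) (\<lambda>a b. sum2 Gs (\<lambda>x' y'. g (hact V (b * y') v) (mscale C (counit H (a * x')) w))) =
        g (hact V x v) w" for x w
    proof -
      have lin: "lin (\<lambda>y. g (hact V (b * y) v) (mscale C c w))" "lin (\<lambda>b. g (hact V b v) w)" for b c
        by (simp_all add: multilinear_simps actV tstD(1,3)[OF g])
      have "g u (mscale C (counit H (a * x')) w) = sc (counit H x') (g u (mscale C (counit H a) w))" for u a x'
        using tstD(4)[OF g, of u "counit H x'" "mscale C (counit H a) w"]
        by (simp add: counit_mult module.scale_scale[OF cal.A.module] mult.commute)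
      then have "sum2 (D x) (\<lambda>a b. sum2 Gs (\<lambda>x' y'. g (hact V (b * y') v) (mscale C (counit H (a * x')) w))) =
          sum2 (D x) (\<lambda>a b. g (hact V (b * 1) v) (mscale C (counit H a) w))"
        using G_counit1[OF lin(1)] by simp
      also have "\<dots> = g (hact V x v) w"
        using counit1[OF lin(2)] by (simp add: tstD(4)[OF g])
      finally show ?thesis .
    qed
    then show ?thesis
      by (simp add: conv_conn_op_mult[OF test_wedge_test[OF g]] dconn_val_def)
  qed
  finally show ?thesis .
qed

text \<open>
  The transpose of \<open>x\<cdot>\<nabla>\<close> on \<open>V \<otimes> \<Omega>\<close>.
\<close>

definition act_ext_test :: "('v \<Rightarrow> 'w \<Rightarrow> 'b) \<Rightarrow> 'h \<Rightarrow> 'v \<Rightarrow> 'w \<Rightarrow> 'b" where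
  "act_ext_test g x v t = sum2 (D x) (\<lambda>a b. act_test (ext_test (act_test g a)) (antipode H b) v t)"

lemma test_act_ext_test: "test g \<Longrightarrow> test (act_ext_test g x)"
  unfolding act_ext_test_def by (intro test_sum2 test_act_test test_ext_test)

lemma act_test_act_ext_test:
  assumes g: "test g"
  shows "act_test (act_ext_test g x) y v t = conv (ext_op g v t) x y"
  unfolding act_ext_test_def act_test_fun conv_def ext_op_def by (simp add: act_test_act_test test_act_test test_ext_test g)

lemma dext_test_eq: "test g \<Longrightarrow> dext_test g = (\<lambda>v t. sum2 Gs (\<lambda>x y. act_test (act_ext_test g x) y v t))"
  by (simp add: fun_eq_iff dext_test_def act_test_act_ext_test)

lemma test_dext_test: "test g \<Longrightarrow> test (dext_test g)"
  by (simp add: dext_test_eq test_sum2 test_act_test test_act_ext_test)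

lemma act_ext_test_linear:
  assumes g: "test g"
  shows "act_ext_test g (x + y) = (\<lambda>v t. act_ext_test g x v t + act_ext_test g y v t)"
    and "act_ext_test g (hscale H k x) = (\<lambda>v t. sc k (act_ext_test g x v t))"
  by (simp_all add: fun_eq_iff act_ext_test_def multilinear_simps act_test_linear act_test_fun ext_test_fun test_act_test test_ext_test g)

text \<open>The equivariance of \<open>conv_mult\<close> for the extended connection, read off at
  argument 1.\<close>

lemma act_ext_test_mult:
  assumes g: "test g"
  shows "(\<lambda>v t. sum2 (D x) (\<lambda>a b. act_test (act_ext_test g (a * z)) b v t)) = act_ext_test (act_test g x) z"
proof (intro ext)
  fix v t
  have "(\<lambda>c. ext_op g v t (x * c)) = ext_op (act_test g x) v t"
    by (simp add: fun_eq_iff ext_op_def act_test_act_test[OF g])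
  then have "sum2 (D x) (\<lambda>a b. act_test (act_ext_test g (a * z)) b v t) = conv (ext_op (act_test g x) v t) z 1"
    using conv_mult[OF bil_ext_op[OF g], of x v t z 1] by (simp add: act_test_act_ext_test[OF g])
  also have "\<dots> = act_ext_test (act_test g x) z v t"
    by (simp add: act_test_one test_act_ext_test test_act_test g flip: act_test_act_ext_test)
  finally show "sum2 (D x) (\<lambda>a b. act_test (act_ext_test g (a * z)) b v t) = act_ext_test (act_test g x) z v t" .
qed

text \<open>The adjoint action distributes over composition through \<Delta>, that is \<xi>\<cdot>(P
  \<circ> Q) = (\<xi>_1\<cdot>P) \<circ> (\<xi>_2\<cdot>Q). Applying \<open>conv_unique\<close>
  reduces this to two successive uses of equivariance, first for the inner and then for the outer
  operator.\<close>

lemma conv_square: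
  assumes g: "test g"
  shows "conv (\<lambda>x y. sum2 Gs (\<lambda>x' y'. conv (conn_op (act_ext_test (act_test g x) x') v) y' y)) x y =
    sum2 Gs (\<lambda>x' y'. sum2 (D x) (\<lambda>a b. conv (conn_op (act_ext_test g (a * x')) v) (b * y') y))"
proof (rule conv_unique)
  have bil: "bil (conv (conn_op (act_ext_test g x) v))" for x
    by (intro bil_conv bil_conn_op test_act_ext_test g)
  have tri: "tri (\<lambda>a b d. conv (conn_op (act_ext_test g (a * x')) v) (b * y') (d * y))" for x' y' y
    using bil by (simp add: multilinear_simps act_ext_test_linear[OF g] conv_fun)
  then show "bil (\<lambda>x y. sum2 Gs (\<lambda>x' y'. sum2 (D x) (\<lambda>a b. conv (conn_op (act_ext_test g (a * x')) v) (b * y') y)))"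
    using bil by (simp add: multilinear_simps act_ext_test_linear[OF g] conv_fun)
  fix x y
  have "sum2 (D x) (\<lambda>c d. sum2 Gs (\<lambda>x' y'. sum2 (D c) (\<lambda>a b. conv (conn_op (act_ext_test g (a * x')) v) (b * y') (d * y)))) =
    sum2 Gs (\<lambda>x' y'. sum2 (D x) (\<lambda>c d. sum2 (D c) (\<lambda>a b. conv (conn_op (act_ext_test g (a * x')) v) (b * y') (d * y))))"
    by (rule sum2_swap)
  also have "\<dots> = sum2 Gs (\<lambda>x' y'. sum2 (D x) (\<lambda>a d. sum2 (D d) (\<lambda>b d. conv (conn_op (act_ext_test g (a * x')) v) (b * y') (d * y))))"
    by (subst D_coassoc[OF tri]) (rule refl)
  also have "\<dots> = sum2 Gs (\<lambda>x' y'. conv (conn_op (act_ext_test (act_test g x) x') v) y' y)"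
    by (simp add: conv_conn_op_mult test_act_ext_test g conv_fun flip: act_ext_test_mult)
  finally show "sum2 (D x) (\<lambda>c d. sum2 Gs (\<lambda>x' y'. sum2 (D c) (\<lambda>a b. conv (conn_op (act_ext_test g (a * x')) v) (b * y') (d * y)))) =
    sum2 Gs (\<lambda>x' y'. conv (conn_op (act_ext_test (act_test g x) x') v) y' y)" .
qed

text \<open>Multiplicativity of D on this composite. After \<open>conv_square\<close> the cocycle
  identity leaves one leg of G on the outer operator and splits the other over inner operator and
  argument; equivariance reads the split leg as an action on the value of the inner operator, which
  is the form of D applied to the outer one.\<close>

lemma square_eq_dext_test:
  assumes g: "test g"
  shows "sum2 Gs (conv (\<lambda>x y. sum2 Gs (\<lambda>x' y'. conv (conn_op (act_ext_test (act_test g x) x') v) y' y))) = dconn_val (dext_test g) v"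
proof -
  have "sum2 Gs (conv (\<lambda>x y. sum2 Gs (\<lambda>x' y'. conv (conn_op (act_ext_test (act_test g x) x') v) y' y))) =
      sum2 Gs (\<lambda>x y. sum2 (D x) (\<lambda>a b. sum2 Gs (\<lambda>x' y'. conv (conn_op (act_ext_test g (a * x')) v) (b * y') y)))"
    by (simp add: conv_square[OF g] sum2_swap[of "D _" Gs] cong: sum2_cong)
  also have "\<dots> = sum2 Gs (\<lambda>x y. sum2 (D y) (\<lambda>a b. sum2 Gs (\<lambda>x' y'. conv (conn_op (act_ext_test g x) v) (a * x') (b * y'))))"
  proof (rule G_cocycle)
    have "bil (conv (conn_op (act_ext_test g x) v))" for x
      by (intro bil_conv bil_conn_op test_act_ext_test g)
    then show "tri (\<lambda>a b c. conv (conn_op (act_ext_test g a) v) b c)"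
      by (simp add: multilinear_simps act_ext_test_linear[OF g] conv_fun)
  qed
  also have "\<dots> = sum2 Gs (\<lambda>x y. sum2 Gs (\<lambda>x' y'. conv (conn_op (act_test (act_ext_test g x) y) v) x' y'))"
    by (simp add: sum2_swap[of "D _" Gs] conv_conn_op_mult test_act_ext_test g)
  also have "\<dots> = dconn_val (dext_test g) v"
    unfolding dext_test_eq[OF g] dconn_val_sum2 by (simp add: dconn_val_def)
  finally show ?thesis .
qed

end

section \<open>Twist deformation of operators\<close>

context connection_setting
begin

lemma map_act_in_tspace:
  assumes "\<And>a b. actT a (P (actX (antipode H b) v)) \<in> tspace (T n)"
  shows "map_act H (T n) actX actT x P v \<in> tspace (T n)"
  unfolding map_act_def by (rule tspace_tens_tsum) (use assms in auto)

lemma pair_map_act: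
  assumes g: "test g" and "\<And>a b. actT a (P (actX (antipode H b) v)) \<in> tspace (T n)"
  shows "pair (T n) g (map_act H (T n) actX actT x P v) =
      sum2 (D x) (\<lambda>a b. pair (T n) g (actT a (P (actX (antipode H b) v))))"
  unfolding map_act_def
  by (subst pair_tens_tsum[OF g]) (use assms(2) in \<open>auto simp: sum2_def case_prod_unfold o_def\<close>)

lemma pair_DF:
  assumes g: "test g" and P: "\<And>v. P v \<in> tspace (T n)"
  shows "DF H F (T n) (hact V) (tens_act H A C V n) P v \<in> tspace (T n)"
    and "pair (T n) g (DF H F (T n) (hact V) (tens_act H A C V n) P v) =
      sum2 Gs (conv (\<lambda>x y. pair (T n) (act_test g x) (P (hact V y v))))"
proof -
  have "map_act H (T n) (hact V) (tens_act H A C V n) x P w \<in> tspace (T n)" for x w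
    by (rule map_act_in_tspace) (rule tens_act_in_tspace[OF P])
  then have all: "set [map_act H (T n) (hact V) (tens_act H A C V n) x P (hact V y v). (x, y) \<leftarrow> Gs] \<subseteq> tspace (T n)"
    by auto
  show "DF H F (T n) (hact V) (tens_act H A C V n) P v \<in> tspace (T n)"
    unfolding DF_def by (rule tspace_tens_tsum[OF all])
  have "pair (T n) g (map_act H (T n) (hact V) (tens_act H A C V n) x P (hact V y v)) =
      conv (\<lambda>x y. pair (T n) (act_test g x) (P (hact V y v))) x y" for x y
    by (subst pair_map_act[OF g])
      (simp_all add: tens_act_in_tspace P pair_tens_act[OF g] conv_def rm.act_mult)
  then show "pair (T n) g (DF H F (T n) (hact V) (tens_act H A C V n) P v) =
      sum2 Gs (conv (\<lambda>x y. pair (T n) (act_test g x) (P (hact V y v))))"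
    unfolding DF_def pair_tens_tsum[OF g all] by (simp add: sum2_def case_prod_unfold o_def)
qed

lemma pair_DF_N:
  assumes g: "test g"
  shows "pair (T 1) g (DF H F (T 1) (hact V) (tens_act H A C V 1) N v) = dconn_val g v"
  unfolding pair_DF(2)[OF g N_in_tspace] by (simp add: dconn_val_def conn_op_def[abs_def] conn_val_def)

lemma square_in_tspace: "star_square H F A C V N v \<in> tspace (T 2)"
  and pair_square: "test g \<Longrightarrow>
    pair (T 2) g (star_square H F A C V N v) = sum2 Gs (\<lambda>x y. conv (conn_op (act_ext_test g x) v) y 1)"
proof -
  let ?M1 = "\<lambda>y. map_act H (T 1) (hact V) (tens_act H A C V 1) y N v"
  let ?M2 = "\<lambda>x. map_act H (T 2) (tens_act H A C V 1) (tens_act H A C V 2) x (extend_conn A C V 1 N)"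
  have M1: "?M1 y \<in> tspace (T 1)" for y
    by (rule map_act_in_tspace) (rule tens_act_in_tspace[OF N_in_tspace])
  have M2: "?M2 x X \<in> tspace (T 2)" if "X \<in> tspace (T 1)" for x X
    by (rule map_act_in_tspace) (intro tens_act_in_tspace extend_in_tspace that)
  have all: "set [(?M2 x \<circ> map_act H (T 1) (hact V) (tens_act H A C V 1) y N) v. (x, y) \<leftarrow> Gs] \<subseteq> tspace (T 2)"
    by (auto intro!: M1 M2)
  show "star_square H F A C V N v \<in> tspace (T 2)"
    unfolding star_square_def by (rule tspace_tens_tsum[OF all])
  assume g: "test g"
  have 1: "pair (T 1) h (?M1 y) = conv (conn_op h v) y 1" if h: "test h" for h y
    by (subst pair_map_act[OF h])
      (simp_all add: tens_act_in_tspace N_in_tspace pair_tens_act[OF h] conv_def conn_op_def conn_val_def)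
  have 2: "pair (T 2) g (?M2 x X) = pair (T 1) (act_ext_test g x) X" if X: "X \<in> tspace (T 1)" for x X
  proof -
    have "pair (T 2) g (?M2 x X) = sum2 (D x) (\<lambda>a b. pair (T 1) (act_test (ext_test (act_test g a)) (antipode H b)) X)"
      by (subst pair_map_act[OF g])
        (simp_all add: tens_act_in_tspace extend_in_tspace X pair_tens_act pair_extend g test_act_test test_ext_test)
    then show ?thesis
      by (simp add: act_ext_test_def[abs_def] pair_def sum2_swap[of "trep (T 1) X"])
  qed
  show "pair (T 2) g (star_square H F A C V N v) = sum2 Gs (\<lambda>x y. conv (conn_op (act_ext_test g x) v) y 1)"
    unfolding star_square_def pair_tens_tsum[OF g all]
    by (simp add: o_def 2 M1 1 test_act_ext_test g case_prod_unfold sum2_def)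
qed

lemma pair_DF_square:
  assumes g: "test g"
  shows "pair (T 2) g (DF H F (T 2) (hact V) (tens_act H A C V 2) (star_square H F A C V N) v) =
    dconn_val (dext_test g) v"
  by (simp add: pair_DF(2)[OF g square_in_tspace] pair_square test_act_test g conv_conn_op_act flip: square_eq_dext_test[OF g])

end

section \<open>Homogeneous components\<close>

context covariant_calculus
begin

text \<open>Composition with a component projection extends functions given on \<Omega>^n to all
  forms, as the definition of test functions requires.\<close>

definition comps :: "'w \<Rightarrow> nat \<Rightarrow> 'w" where
  "comps w = (THE f. (\<forall>n. f n \<in> deg C n) \<and> finite {n. f n \<noteq> 0} \<and> w = (\<Sum>n | f n \<noteq> 0. f n))"

lemma comps_eqI:
  assumes "\<And>n. f n \<in> deg C n" "finite S" "\<And>n. n \<notin> S \<Longrightarrow> f n = 0" "w = (\<Sum>n\<in>S. f n)"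
  shows "comps w = f"
proof -
  have "{n. f n \<noteq> 0} \<subseteq> S"
    using assms(3) by blast
  then have "finite {n. f n \<noteq> 0}" "w = (\<Sum>n | f n \<noteq> 0. f n)"
    using assms(2,4) by (auto intro: finite_subset sum.mono_neutral_right)
  then show ?thesis
    unfolding comps_def using direct_sum[of w] assms(1) by (intro the1_equality) auto
qed

lemma comps: "comps w n \<in> deg C n" "finite {n. comps w n \<noteq> 0}" "w = (\<Sum>n | comps w n \<noteq> 0. comps w n)"
  using theI'[OF direct_sum[of w]] unfolding comps_def by blast+

lemma comps_add: "comps (w + w') n = comps w n + comps w' n"
proof -
  let ?S = "{n. comps w n \<noteq> 0} \<union> {n. comps w' n \<noteq> 0}"
  have "w = (\<Sum>n\<in>?S. comps w n)" "w' = (\<Sum>n\<in>?S. comps w' n)"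
    using comps(2,3)[of w] comps(2,3)[of w'] by (auto intro: trans[OF _ sum.mono_neutral_left])
  then have "w + w' = (\<Sum>n\<in>?S. comps w n + comps w' n)"
    by (simp add: sum.distrib)
  moreover have "comps w n + comps w' n \<in> deg C n" for n
    by (rule module.subspace_add[OF A.module deg_subspace]) (rule comps)+
  ultimately have "comps (w + w') = (\<lambda>n. comps w n + comps w' n)"
    by (intro comps_eqI[of _ ?S]) (auto simp: comps)
  then show ?thesis by simp
qed

lemma comps_hom:
  assumes add: "\<And>s t. f (s + t) = f s + f t" and deg: "\<And>n t. t \<in> deg C n \<Longrightarrow> f t \<in> deg C n"
  shows "comps (f w) n = f (comps w n)"
proof -
  let ?S = "{n. comps w n \<noteq> 0}"
  have zero: "f 0 = 0"
    by (metis add add_cancel_right_right)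
  have "f (sum h S) = (\<Sum>n\<in>S. f (h n))" for h and S :: "nat set"
    by (induction S rule: infinite_finite_induct) (simp_all add: zero add)
  then have "f w = (\<Sum>n\<in>?S. f (comps w n))"
    by (metis comps(3))
  then have "comps (f w) = (\<lambda>n. f (comps w n))"
    by (intro comps_eqI[of _ ?S]) (auto simp: comps deg zero)
  then show ?thesis by simp
qed

lemma comps_homogeneous:
  assumes "t \<in> deg C n"
  shows "comps t n = t"
proof -
  have "comps t = (\<lambda>m. if m = n then t else 0)"
    by (rule comps_eqI[of _ "{n}"]) (use assms in \<open>auto intro: module.subspace_0[OF A.module deg_subspace]\<close>)
  then show ?thesis by simp
qed

end

section \<open>The deformed calculus\<close>

context calculus_setting
begin

abbreviation CS :: "('k, 'h, 'w) calculus" where "CS \<equiv> star_alg H F C"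

abbreviation VS :: "('k, 'h, 'w, 'v) rmod" where "VS \<equiv> star_mod H F C V"

abbreviation Ts :: "nat \<Rightarrow> ('v \<times> 'w) tprod" where "Ts n \<equiv> tens A CS VS n"

abbreviation star_test :: "('v \<Rightarrow> 'w \<Rightarrow> 'b) \<Rightarrow> bool" where "star_test \<equiv> test_fun A CS VS sc"

lemma star_simps [simp]: "deg CS = deg C" "diff CS = diff C" "mscale VS = mscale V"
  "mult CS s t = sum2 Gs (\<lambda>x y. mult C (hact C x s) (hact C y t))"
  "ract VS v a = sum2 Gs (\<lambda>x y. ract V (hact V x v) (hact C y a))"
  by (simp_all add: star_alg_def star_mod_def sum2_def)

lemma mscaleV: "mscale V k (v + w) = mscale V k v + mscale V k w"
  by (rule module.scale_right_distrib[OF rm.module])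

lemma mscaleC: "mscale C k (v + w) = mscale C k v + mscale C k w"
  by (rule module.scale_right_distrib[OF cal.A.module])

lemma sum_in_deg: "(\<And>a b. f a b \<in> deg C n) \<Longrightarrow> sum2 xs f \<in> deg C n"
  by (induction xs) (auto simp: module.subspace_0[OF cal.A.module cal.deg_subspace]
      module.subspace_add[OF cal.A.module cal.deg_subspace])

lemma deg_star_mult: "s \<in> deg C m \<Longrightarrow> t \<in> deg C n \<Longrightarrow> mult CS s t \<in> deg C (m + n)"
  by (auto intro!: sum_in_deg cal.deg_mult cal.deg_act)

text \<open>\<open>H\<close> acts on multiples of the unit through \<epsilon>, so the counit
  identities of G reduce deformed multiplication by a scalar to the undeformed one. They are used
  with values in the modules themselves.\<close>

lemma star_scale_by_unit:
  "mscale V k v = ract VS v (mscale C k (unit C))" "mscale C k t = mult CS (mscale C k (unit C)) t"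
proof -
  interpret VT: twisted_target H "mscale V" F
    by unfold_locales (rule mscaleV, rule twist)
  interpret CT: twisted_target H "mscale C" F
    by unfold_locales (rule mscaleC, rule twist)
  have unit: "hact C x (mscale C k (unit C)) = mscale C (counit H x) (mscale C k (unit C))" for x
    by (simp add: actC cal.A.act_unit module.scale_left_commute[OF cal.A.module])
  have "VT.lin (\<lambda>x. mscale V k (hact V x v))"
    by (simp add: VT.lin_def actV mscaleV module.scale_left_commute[OF rm.module])
  from VT.G_counit2[OF this] show "mscale V k v = ract VS v (mscale C k (unit C))"
    by (simp add: unit rm.act_one rm.ract_scale scale_closed cal.A.unit_closed rm.ract_unit)
  have "CT.lin (\<lambda>x. mscale C k (hact C x t))"
    by (simp add: CT.lin_def actC mscaleC module.scale_left_commute[OF cal.A.module])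
  from CT.G_counit1[OF this] show "mscale C k t = mult CS (mscale C k (unit C)) t"
    by (simp add: unit cal.A.act_one multC cal.forms.unit_left)
qed

lemma tstsD:
  assumes "star_test g"
  shows "g (v + v') t = g v t + g v' t" "g v (t + t') = g v t + g v t'"
    "g (mscale V k v) t = sc k (g v t)" "g v (mscale C k t) = sc k (g v t)"
proof -
  show "g (v + v') t = g v t + g v' t" "g v (t + t') = g v t + g v t'"
    and s: "g (mscale V k v) t = sc k (g v t)"
    using assms by (simp_all add: test_fun_def del: star_simps(4,5))
  have "g (ract VS v (mscale C k (unit C))) t = g v (mult CS (mscale C k (unit C)) t)"
    using assms scale_closed[OF cal.A.unit_closed] by (simp add: test_fun_def del: star_simps(4,5))
  then show "g v (mscale C k t) = sc k (g v t)"
    by (simp add: s flip: star_scale_by_unit del: star_simps(4,5))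
qed

lemma star_test_balanced: "star_test g \<Longrightarrow> a \<in> A \<Longrightarrow> g (ract VS v a) t = g v (mult CS a t)"
  by (simp add: test_fun_def del: star_simps(4,5))

lemma star_test_sum:
  assumes "star_test g"
  shows "g (sum2 xs f) t = sum2 xs (\<lambda>a b. g (f a b) t)" "g v (sum2 xs h) = sum2 xs (\<lambda>a b. g v (h a b))"
  using sum2_hom[of "\<lambda>v. g v t"] sum2_hom[of "g v"] tstsD[OF assms] by simp_all

text \<open>
  The transposes of \<open>\<phi>\<close> and of its inverse.
\<close>

definition pull :: "('v \<Rightarrow> 'w \<Rightarrow> 'b) \<Rightarrow> 'v \<Rightarrow> 'w \<Rightarrow> 'b" where
  "pull g v t = sum2 Gs (\<lambda>x y. g (hact V x v) (hact C y t))"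

definition push :: "('v \<Rightarrow> 'w \<Rightarrow> 'b) \<Rightarrow> 'v \<Rightarrow> 'w \<Rightarrow> 'b" where
  "push g v t = sum2 Fs (\<lambda>x y. g (hact V x v) (hact C y t))"

text \<open>The cocycle identity for G, in the form that underlies both the well-definedness of
  \<phi> over the deformed algebra and its compatibility with the deformed wedge product.\<close>

lemma pull_mult:
  assumes g: "test g"
  shows "pull g u (mult CS s t) = sum2 Gs (\<lambda>x y. sum2 (D x) (\<lambda>a b. sum2 Gs (\<lambda>x' y'.
    g (hact V (a * x') u) (mult C (hact C (b * y') s) (hact C y t)))))"
proof -
  have act_sum: "hact C y (sum2 xs f) = sum2 xs (\<lambda>a b. hact C y (f a b))" for y xs f
    by (rule sum2_hom) (rule actC)
  have "pull g u (mult CS s t) = sum2 Gs (\<lambda>x y. sum2 (D y) (\<lambda>a b. sum2 Gs (\<lambda>x' y'.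
      g (hact V x u) (mult C (hact C (a * x') s) (hact C (b * y') t)))))"
    by (simp add: pull_def act_sum act_mult2 test_sum[OF g] cal.A.act_mult sum2_swap[of "D _" Gs])
  also have "\<dots> = sum2 Gs (\<lambda>x y. sum2 (D x) (\<lambda>a b. sum2 Gs (\<lambda>x' y'.
      g (hact V (a * x') u) (mult C (hact C (b * y') s) (hact C y t)))))"
    by (rule G_cocycle[symmetric]) (simp add: multilinear_simps actV actC multC tstD[OF g])
  finally show ?thesis .
qed

text \<open>Transposes the identity that \<phi> takes the deformed product of X with t to the sum of
  (x \<triangleright> \<phi>(X)) \<and> (y \<triangleright> t) over G.\<close>

lemma pull_mult_act_test:
  assumes g: "test g"
  shows "pull g u (mult CS s t) = sum2 Gs (\<lambda>x y. pull (act_test (wedge_test g (hact C y t)) x) u s)"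
  unfolding pull_mult[OF g]
  by (simp add: pull_def act_test_def wedge_test_def rm.act_mult cal.A.act_mult sum2_swap[of "D _" Gs])

lemma star_test_pull:
  assumes g: "test g"
  shows "star_test (pull g)"
proof -
  have act_sum: "hact V y (sum2 xs f) = sum2 xs (\<lambda>a b. hact V y (f a b))" for y xs f
    by (rule sum2_hom) (rule actV)
  have "pull g (ract VS v a) t = pull g v (mult CS a t)" if a: "a \<in> A" for v a t
    unfolding pull_mult[OF g]
    by (simp add: pull_def act_sum act_ract2 cal.A.act_closed a test_sum[OF g] test_balanced[OF g]
        rm.act_mult cal.A.act_mult sum2_swap[of "D _" Gs])
  then show ?thesis
    by (simp add: test_fun_def pull_def actV actC tstD[OF g] sum2_add sc_sum2 del: star_simps(4,5))
qed

lemma push_pull: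
  assumes g: "test g"
  shows "sum2 Fs (\<lambda>x y. pull g (hact V x v) (hact C y t)) = g v t"
proof -
  have "sum2 Gs (\<lambda>x y. sum2 Fs (\<lambda>a b. g (hact V (x * a) v) (hact C (y * b) t))) = g (hact V 1 v) (hact C 1 t)"
    by (rule G_F) (simp add: multilinear_simps actV actC tstD[OF g])
  then show ?thesis
    by (simp add: pull_def rm.act_mult cal.A.act_mult sum2_swap[of Fs Gs] rm.act_one cal.A.act_one)
qed

lemma pull_push:
  assumes g: "star_test g"
  shows "pull (push g) = g"
proof (intro ext)
  fix v t
  have "sum2 Fs (\<lambda>x y. sum2 Gs (\<lambda>a b. g (hact V (x * a) v) (hact C (y * b) t))) = g (hact V 1 v) (hact C 1 t)"
    by (rule F_G) (simp add: multilinear_simps actV actC tstsD[OF g])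
  then show "pull (push g) v t = g v t"
    by (simp add: pull_def push_def rm.act_mult cal.A.act_mult sum2_swap[of Gs Fs] rm.act_one cal.A.act_one)
qed

text \<open>Well-definedness of the inverse of \<phi>: undeformed products are deformed products of
  arguments acted on by F, and the cocycle identity of F then matches the two sides of the balancing
  relation.\<close>

lemma test_push:
  assumes g: "star_test g"
  shows "test (push g)"
proof -
  have "push g (ract V v a) t = push g v (mult C a t)" if a: "a \<in> A" for v a t
  proof -
    \<comment> \<open>Inserting GF = 1 in front of the arguments exhibits the deformed
      action.\<close>
    have 1: "g (ract V u b) s = sum2 Fs (\<lambda>x y. g (ract VS (hact V x u) (hact C y b)) s)" if b: "b \<in> A" for u b s
    proof -
      have "sum2 Gs (\<lambda>x y. sum2 Fs (\<lambda>c d. g (ract V (hact V (x * c) u) (hact C (y * d) b)) s)) =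
          g (ract V (hact V 1 u) (hact C 1 b)) s"
        by (rule G_F) (simp add: multilinear_simps actV actC ractV rm.ract_add rm.ract_scale
            cal.A.act_closed b tstsD[OF g])
      then show ?thesis
        by (simp add: rm.act_mult cal.A.act_mult rm.act_one cal.A.act_one star_test_sum[OF g] sum2_swap[of Fs Gs])
    qed
    have 2: "g u (mult C b s) = sum2 Fs (\<lambda>x y. g u (mult CS (hact C x b) (hact C y s)))" for u b s
    proof -
      have "sum2 Gs (\<lambda>x y. sum2 Fs (\<lambda>c d. g u (mult C (hact C (x * c) b) (hact C (y * d) s)))) =
          g u (mult C (hact C 1 b) (hact C 1 s))"
        by (rule G_F) (simp add: multilinear_simps actC multC tstsD[OF g])
      then show ?thesis
        by (simp add: cal.A.act_mult cal.A.act_one star_test_sum[OF g] sum2_swap[of Fs Gs])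
    qed
    have "push g (ract V v a) t = sum2 Fs (\<lambda>x y. sum2 (D x) (\<lambda>b c. sum2 Fs (\<lambda>x' y'.
        g (hact V (x' * b) v) (mult CS (hact C (y' * c) a) (hact C y t)))))"
      by (simp add: push_def act_ract2 a star_test_sum(1)[OF g] 1 cal.A.act_closed star_test_balanced[OF g]
          rm.act_mult cal.A.act_mult del: star_simps(4,5))
    also have "\<dots> = sum2 Fs (\<lambda>x y. sum2 (D y) (\<lambda>b c. sum2 Fs (\<lambda>x' y'.
        g (hact V x v) (mult CS (hact C (x' * b) a) (hact C (y' * c) t)))))"
      by (rule F_cocycle) (simp add: multilinear_simps actV actC multC star_test_sum[OF g] tstsD[OF g])
    also have "\<dots> = push g v (mult C a t)"
      by (simp add: push_def act_mult2 star_test_sum(2)[OF g] 2 cal.A.act_mult del: star_simps(4,5))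
    finally show ?thesis .
  qed
  then show ?thesis
    by (simp add: test_fun_def push_def actV actC tstsD[OF g] sum2_add sc_sum2)
qed

section \<open>The isomorphism \<phi> under test functions\<close>

lemma trep_Ts: "X \<in> tspace (Ts n) \<Longrightarrow> (v, t) \<in> set (trep (Ts n) X) \<Longrightarrow> t \<in> deg C n"
  using trep_tens[of X A CS VS n v t] by simp

lemma phi_in_tspace: "X \<in> tspace (Ts n) \<Longrightarrow> phi H F A C V n X \<in> tspace (T n)"
  unfolding phi_def by (rule tcls_tens_in_tspace) (auto dest: trep_Ts intro: cal.deg_act)

lemma pair_phi:
  assumes g: "test g" and X: "X \<in> tspace (Ts n)"
  shows "pair (T n) g (phi H F A C V n X) = pair (Ts n) (pull g) X"
proof -
  let ?xs = "[(hact V x v, hact C y t). (v, t) \<leftarrow> trep (Ts n) X, (x, y) \<leftarrow> Gs]"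
  have "set ?xs \<subseteq> UNIV \<times> deg C n"
    using X by (auto dest: trep_Ts intro: cal.deg_act)
  then have "pair (T n) g (phi H F A C V n X) = sum2 ?xs g"
    unfolding phi_def by (rule pair_tens_tcls[OF g])
  then show ?thesis
    by (simp add: pair_def pull_def[abs_def] sum2_def sum_list_concat_map case_prod_unfold o_def)
qed

text \<open>The preimage is F applied to an expression of \<open>X\<close>. Equality holds so far
  only under test functions with values in the fixed group; it becomes equality of tensors once that
  group separates them.\<close>

lemma phi_pair_surj:
  assumes X: "X \<in> tspace (T n)"
  shows "\<exists>Y\<in>tspace (Ts n). \<forall>g. test g \<longrightarrow> pair (T n) g (phi H F A C V n Y) = pair (T n) g X"
proof -
  let ?ys = "[(hact V x v, hact C y t). (v, t) \<leftarrow> trep (T n) X, (x, y) \<leftarrow> Fs]"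
  have ys: "set ?ys \<subseteq> UNIV \<times> deg CS n"
    using X by (auto dest: trep_tens intro: cal.deg_act)
  note Y = tcls_tens_in_tspace[OF ys, of A VS]
  have "pair (T n) g (phi H F A C V n (tcls (Ts n) ?ys)) = pair (T n) g X" if g: "test g" for g
  proof -
    have "pair (T n) g (phi H F A C V n (tcls (Ts n) ?ys)) = sum2 ?ys (pull g)"
      unfolding pair_phi[OF g Y] by (rule pair_tens_tcls[OF star_test_pull[OF g] ys])
    also have "\<dots> = sum2 (trep (T n) X) (\<lambda>v t. sum2 Fs (\<lambda>x y. pull g (hact V x v) (hact C y t)))"
      by (simp add: sum2_def sum_list_concat_map case_prod_unfold o_def)
    finally show ?thesis
      by (simp add: push_pull[OF g] pair_def)
  qed
  with Y show ?thesis
    by blast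
qed

lemma phi_pair_inj:
  assumes "X \<in> tspace (Ts n)" "Y \<in> tspace (Ts n)" "phi H F A C V n X = phi H F A C V n Y" and g: "star_test g"
  shows "pair (Ts n) g X = pair (Ts n) g Y"
  using pair_phi[OF test_push[OF g] assms(1)] pair_phi[OF test_push[OF g] assms(2)] assms(3)
  by (simp add: pull_push[OF g])

text \<open>Multiplication by elements of degree 0 preserves degrees and so commutes with the
  projection; this keeps the extended function balanced.\<close>

lemma test_extend:
  assumes "bilin (ract V) A (mult C) (deg C n) g" "\<And>k v t. t \<in> deg C n \<Longrightarrow> g (mscale V k v) t = sc k (g v t)"
  shows "test (\<lambda>v t. g v (cal.comps t n))"
proof -
  have "cal.comps (mult C a t) n = mult C a (cal.comps t n)" if "a \<in> A" for a t
    by (rule cal.comps_hom) (use cal.deg_mult[of a 0] that in \<open>auto simp: multC cal.deg_zero\<close>)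
  then show ?thesis
    using assms cal.comps(1)[of _ n] by (simp add: test_fun_def bilin_def cal.comps_add)
qed

lemma star_test_extend:
  assumes "bilin (ract VS) A (mult CS) (deg C n) g" "\<And>k v t. t \<in> deg C n \<Longrightarrow> g (mscale V k v) t = sc k (g v t)"
  shows "star_test (\<lambda>v t. g v (cal.comps t n))"
proof -
  have "cal.comps (mult CS a t) n = mult CS a (cal.comps t n)" if a: "a \<in> A" for a t
  proof (rule cal.comps_hom)
    show "mult CS a (s + t) = mult CS a s + mult CS a t" for s t
      by (simp add: actC multC sum2_add)
    show "mult CS a t \<in> deg C n" if "t \<in> deg C n" for n t
      using deg_star_mult[of a 0 t n] that a by (simp add: cal.deg_zero)
  qed
  then show ?thesis
    using assms cal.comps(1)[of _ n]
    by (simp add: test_fun_def bilin_def cal.comps_add del: star_simps(4,5))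
qed

end

context connection_setting
begin

text \<open>By \<open>pull_mult_act_test\<close> the wedge term depends on \<open>Ns\<close> only
  through its image under \<phi>, which is D(\<nabla>); the result is the right-hand side of
  \<open>dext_test_twisted\<close>.\<close>

lemma pair_phi_extend_star:
  assumes g: "test g" and X: "X \<in> tspace (Ts 1)"
    and Ns: "\<And>v. Ns v \<in> tspace (Ts 1)"
    and phi_Ns: "\<And>v. phi H F A C V 1 (Ns v) = DF H F (T 1) (hact V) (tens_act H A C V 1) N v"
  shows "extend_conn A CS VS 1 Ns X \<in> tspace (Ts 2)"
    and "pair (T 2) g (phi H F A C V 2 (extend_conn A CS VS 1 Ns X)) = pair (T 1) (dext_test g) (phi H F A C V 1 X)"
proof -
  have m: "mult CS s t \<in> deg CS 2" if "s \<in> deg CS 1" "t \<in> deg CS 1" for s t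
    using deg_star_mult[of s 1 t 1] that by (simp add: one_add_one del: star_simps(4,5))
  have d: "diff CS t \<in> deg CS 2" if "t \<in> deg CS 1" for t
    using cal.deg_diff[of t 1] that by (simp add: one_add_one)
  show in_ts: "extend_conn A CS VS 1 Ns X \<in> tspace (Ts 2)"
    by (rule pair_extend_conn(1)[OF star_test_pull[OF g] X], rule Ns, rule m, assumption+, rule d)
  have conn_val: "pair (Ts 1) (pull h) (Ns v) = dconn_val h v" if "test h" for h v
    by (simp add: phi_Ns pair_DF_N that flip: pair_phi[OF that Ns])
  have *: "pair (Ts 1) (\<lambda>u s. pull g u (mult CS s t)) (Ns v) + pull g v (diff CS t) = pull (dext_test g) v t" for v t
  proof -
    have "pair (Ts 1) (\<lambda>u s. pull g u (mult CS s t)) (Ns v) =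
        sum2 Gs (\<lambda>x y. pair (Ts 1) (pull (act_test (wedge_test g (hact C y t)) x)) (Ns v))"
      unfolding pull_mult_act_test[OF g] by (simp add: pair_def sum2_swap[of _ Gs])
    also have "\<dots> = sum2 Gs (\<lambda>x y. dconn_val (act_test (wedge_test g (hact C y t)) x) v)"
      by (simp add: conn_val test_act_test test_wedge_test g)
    finally show ?thesis
      by (simp add: pull_def dext_test_twisted[OF g] sum2_add cal.act_diff del: star_simps(4,5))
  qed
  have "pair (Ts 2) (pull g) (extend_conn A CS VS 1 Ns X) = pair (Ts 1) (pull (dext_test g)) X"
    unfolding *[symmetric]
    by (rule pair_extend_conn(2)[OF star_test_pull[OF g] X], rule Ns, rule m, assumption+, rule d)
  then show "pair (T 2) g (phi H F A C V 2 (extend_conn A CS VS 1 Ns X)) = pair (T 1) (dext_test g) (phi H F A C V 1 X)"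
    by (simp only: pair_phi[OF g in_ts] pair_phi[OF test_dext_test[OF g] X])
qed

end

theorem mainTheorem12:
  fixes H :: "('k::comm_ring_1, 'h::ring_1) hopf"
    and F :: "('h \<times> 'h) tensor"
    and A :: "'w::ab_group_add set"
    and C :: "('k, 'h, 'w) calculus"
    and V :: "('k, 'h, 'w, 'v::ab_group_add) rmod"
    and nabla nabla_star :: "'v \<Rightarrow> ('v \<times> 'w) tensor"
  assumes "hopf_algebra H"
    and "twist H F"
    and "module_algebra H A C"
    and "covariant_calculus H A C"
    and "module_right_module H A C V"
    and "nabla \<in> connections A C V"
    and "nabla_star = DF_tilde H F A C V 1 nabla"
  shows "curvature A (star_alg H F C) (star_mod H F C V) nabla_star
       = DF_tilde H F A C V 2 (star_square H F A C V nabla)"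
proof -
  \<comment> \<open>This is the group of values for which \<open>tensor_eqI\<close> makes test
    functions separate tensors.\<close>
  interpret hopf_target H "fsc :: 'k \<Rightarrow> ('k \<Rightarrow> ('v \<times> 'w \<Rightarrow>\<^sub>0 int) allquot) \<Rightarrow> _"
    by (rule hopf_target_fsc[OF assms(1)])
  interpret cal: covariant_calculus H A C by (rule assms(4))
  interpret rm: module_right_module H A C V by (rule assms(5))
  interpret connection_setting H "fsc :: 'k \<Rightarrow> ('k \<Rightarrow> ('v \<times> 'w \<Rightarrow>\<^sub>0 int) allquot) \<Rightarrow> _" F A C V nabla
    by unfold_locales (rule assms(2), rule assms(6))
  have T_eqI: "X = Y" if X: "X \<in> tspace (T n)" and Y: "Y \<in> tspace (T n)"
    and eq: "\<And>g. test g \<Longrightarrow> pair (T n) g X = pair (T n) g Y" for X Y n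
  proof (rule tensor_eqI[where s = "mscale V" and T = "T n", OF tens_def X Y])
    fix g :: "'v \<Rightarrow> 'w \<Rightarrow> 'k \<Rightarrow> ('v \<times> 'w \<Rightarrow>\<^sub>0 int) allquot"
    assume "bilin (ract V) A (mult C) (deg C n) g"
      and "\<And>k v t. t \<in> deg C n \<Longrightarrow> g (mscale V k v) t = fsc k (g v t)"
    \<comment> \<open>\<open>g\<close> is balanced in degree \<open>n\<close> only. Its extension is
      a test function and agrees with it on expressions of tensors, whose forms have degree
      \<open>n\<close>.\<close>
    then have "test (\<lambda>v t. g v (cal.comps t n))"
      by (rule test_extend)
    moreover have "pair (T n) (\<lambda>v t. g v (cal.comps t n)) Z = pair (T n) g Z" if "Z \<in> tspace (T n)" for Z
      unfolding pair_def by (rule sum2_cong) (simp add: cal.comps_homogeneous trep_tens[OF that])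
    ultimately show "pair (T n) g X = pair (T n) g Y"
      using eq X Y by metis
  qed (simp_all add: mscaleV ractV module.scale_scale[OF rm.module] module.scale_one[OF rm.module])
  have Ts_eqI: "X = Y" if X: "X \<in> tspace (Ts n)" and Y: "Y \<in> tspace (Ts n)"
    and eq: "\<And>g. star_test g \<Longrightarrow> pair (Ts n) g X = pair (Ts n) g Y" for X Y n
  proof (rule tensor_eqI[where s = "mscale V" and T = "Ts n", OF tens_def X Y])
    fix g :: "'v \<Rightarrow> 'w \<Rightarrow> 'k \<Rightarrow> ('v \<times> 'w \<Rightarrow>\<^sub>0 int) allquot"
    assume "bilin (ract VS) A (mult CS) (deg CS n) g"
      and "\<And>k v t. t \<in> deg CS n \<Longrightarrow> g (mscale V k v) t = fsc k (g v t)"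
    then have "star_test (\<lambda>v t. g v (cal.comps t n))"
      by (intro star_test_extend) simp_all
    moreover have "pair (Ts n) (\<lambda>v t. g v (cal.comps t n)) Z = pair (Ts n) g Z" if "Z \<in> tspace (Ts n)" for Z
      unfolding pair_def by (rule sum2_cong) (use trep_tens[OF that] in \<open>simp add: cal.comps_homogeneous\<close>)
    ultimately show "pair (Ts n) g X = pair (Ts n) g Y"
      using eq X Y by metis
  next
    show "mscale V k (ract VS v a) = ract VS (mscale V k v) a" if "a \<in> A" for k v a
      using that by (simp add: actV ractV cal.A.act_closed sum2_hom[of "mscale V k"] mscaleV)
  qed (simp_all add: mscaleV module.scale_scale[OF rm.module] module.scale_one[OF rm.module])
  have inj: "inj_on (phi H F A C V n) (tspace (Ts n))" for n
    by (intro inj_onI Ts_eqI) (auto intro: phi_pair_inj)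
  have surj: "X \<in> phi H F A C V n ` tspace (Ts n)" if X: "X \<in> tspace (T n)" for X n
  proof -
    obtain Y where Y: "Y \<in> tspace (Ts n)"
        "\<And>g. test g \<Longrightarrow> pair (T n) g (phi H F A C V n Y) = pair (T n) g X"
      using phi_pair_surj[OF X] by blast
    have "phi H F A C V n Y = X"
      by (rule T_eqI[OF phi_in_tspace[OF Y(1)] X Y(2)])
    with Y(1) show ?thesis by blast
  qed
  \<comment> \<open>Supplied to lemmas that carry a test function when only their membership
    conclusion is used.\<close>
  have test_zero: "test (\<lambda>_ _. 0)"
    by (simp add: test_fun_def fsc_def fun_eq_iff)
  have DN: "DF H F (T 1) (hact V) (tens_act H A C V 1) nabla v \<in> tspace (T 1)" for v
    by (rule pair_DF(1)[OF test_zero N_in_tspace])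
  have Ns: "nabla_star v \<in> tspace (Ts 1)"
    and phi_Ns: "phi H F A C V 1 (nabla_star v) = DF H F (T 1) (hact V) (tens_act H A C V 1) nabla v" for v
    using surj[OF DN[of v]] unfolding assms(7) DF_tilde_def o_def
    by (rule inv_into_into, rule f_inv_into_f)
  show ?thesis
  proof
    fix v
    let ?R = "extend_conn A CS VS 1 nabla_star (nabla_star v)"
    let ?S = "DF H F (T 2) (hact V) (tens_act H A C V 2) (star_square H F A C V nabla) v"
    note R = pair_phi_extend_star[OF _ Ns Ns phi_Ns]
    \<comment> \<open>Both sides pair with \<open>g\<close> to
      \<open>dconn_val (dext_test g) v\<close>.\<close>
    have "phi H F A C V 2 ?R = ?S"
    proof (rule T_eqI)
      show "phi H F A C V 2 ?R \<in> tspace (T 2)"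
        by (rule phi_in_tspace[OF R(1)[OF test_zero]])
      show "?S \<in> tspace (T 2)"
        by (rule pair_DF(1)[OF test_zero square_in_tspace])
      show "pair (T 2) g (phi H F A C V 2 ?R) = pair (T 2) g ?S" if g: "test g" for g
        by (simp only: R(2)[OF g] phi_Ns pair_DF_N[OF test_dext_test[OF g]] pair_DF_square[OF g])
    qed
    then have "inv_into (tspace (Ts 2)) (phi H F A C V 2) ?S = ?R"
      by (rule inv_into_f_eq[OF inj R(1)[OF test_zero]])
    then show "curvature A CS VS nabla_star v = DF_tilde H F A C V 2 (star_square H F A C V nabla) v"
      by (simp add: curvature_def DF_tilde_def)
  qed
qed

end
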